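(* Let $\mathbb{T}$ be a time scale and $f:\mathbb{T}\to\mathbb{R}_{\mathcal{F}}$. Suppose that $f$ is $\nabla_{gH}$-differentiable at a point $t\in\mathbb{T}_\kappa$ and that $f$ is continuous on $U_{\mathbb{T}}=(t-\delta,t+\delta)\cap\mathbb{T}$ for some $\delta>0$. Assume further that for every left-scattered point $s\in U_{\mathbb{T}}$, either the Hukuhara differences $f(t)\ominus_H f(s)$ and $f(t)\ominus_H f(\rho(s))$ exist, or the Hukuhara differences $f(s)\ominus_H f(t)$ and $f(\rho(s))\ominus_H f(t)$ exist. Then one of the following cases holds: (i) The functions $f_\alpha^-$ and $f_\alpha^+$ are $\nabla$-differentiable at $t$ for all $\alpha\in[0,1]$, uniformly in $\alpha$, and either $[\nabla_{gH}f(t)]_\alpha=[\nabla f_\alpha^-(t),\nabla f_\alpha^+(t)]$ for all $\alpha\in[0,1]$, or $[\nabla_{gH}f(t)]_\alpha=[\nabla f_\alpha^+(t),\nabla f_\alpha^-(t)]$ for all $\alpha\in[0,1]$. (ii) The one-sided derivatives $\nabla_-f_\alpha^-(t)$, $\nabla_+f_\alpha^-(t)$, $\nabla_-f_\alpha^+(t)$, $\nabla_+f_\alpha^+(t)$ exist for all $\alpha\in[0,1]$, uniformly in $\alpha$, and satisfy $\nabla_-f_\alpha^-(t)=\nabla_+f_\alpha^+(t)$ and $\nabla_+f_\alpha^-(t)=\nabla_-f_\alpha^+(t)$. Furthermore, either $$[\nabla_{gH}f(t)]_\alpha=[\nabla_+f_\alpha^-(t),\nabla_+f_\alpha^+(t)]=[\nabla_-f_\alpha^+(t),\nabla_-f_\alpha^-(t)]\quad\text{for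 all }\alpha\in[0,1],$$ or $$[\nabla_{gH}f(t)]_\alpha=[\nabla_-f_\alpha^-(t),\nabla_-f_\alpha^+(t)]=[\nabla_+f_\alpha^+(t),\nabla_+f_\alpha^-(t)]\quad\text{for all }\alpha\in[0,1].$$
   Context: A time scale $\mathbb{T}$ is a (nonempty) closed subset of $\mathbb{R}$. $\sigma(t)=\inf\{s\in\mathbb{T}:s>t\}$, $\rho(t)=\sup\{s\in\mathbb{T}:s<t\}$ (with $\inf\emptyset=\sup\mathbb{T}$, $\sup\emptyset=\inf\mathbb{T}$). $t$ is left-scattered if $\rho(t)<t$, right-scattered if $\sigma(t)>t$. $\mathbb{T}_\kappa=\mathbb{T}\setminus\{m\}$ if $\mathbb{T}$ has a right-scattered minimum $m$, otherwise $\mathbb{T}_\kappa=\mathbb{T}$. $\nu(t)=t-\rho(t)$. For $\varphi:\mathbb{T}\to\mathbb{R}$ and $t\in\mathbb{T}_\kappa$, $\nabla\varphi(t)$ is the number (if it exists) such that for every $\varepsilon>0$ there is a neighborhood $U$ of $t$ in $\mathbb{T}$ with $|\varphi(\rho(t))-\varphi(s)-\nabla\varphi(t)(\rho(t)-s)|\le\varepsilon|\rho(t)-s|$ for all $s\in U$. One-sided derivatives: $\nabla_\pm\varphi(t)=\lim_{h\to0^\pm,\,t+h\in\mathbb{T}}\frac{\varphi(t+h)-\varphi(\rho(t))}{h+\nu(t)}$; on a side on which $t$ is not a limit of points of $\mathbb{T}$, the one-sided derivative is $\frac{\varphi(t)-\varphi(\rho(t))}{\nu(t)}$ if $t$ is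 left-scattered, and does not exist if $\rho(t)=t$. Existence for all $\alpha$ "uniformly in $\alpha$" means that the neighborhood in the defining limit can be chosen, for each $\varepsilon$, independently of $\alpha\in[0,1]$. A fuzzy number is $u:\mathbb{R}\to[0,1]$ that is normal ($u(x_0)=1$ for some $x_0$), quasi-concave ($u(\lambda x+(1-\lambda)y)\ge\min\{u(x),u(y)\}$ for $\lambda\in[0,1]$), upper semicontinuous, and with compact support $\mathrm{cl}\{x:u(x)>0\}$. $\mathbb{R}_{\mathcal{F}}$ is the set of fuzzy numbers. Level sets: $[u]_\alpha=\{x:u(x)\ge\alpha\}$ for $0<\alpha\le1$, $[u]_0=\mathrm{cl}\{x:u(x)>0\}$; they are compact intervals $[u_\alpha^-,u_\alpha^+]$. For $f:\mathbb{T}\to\mathbb{R}_{\mathcal{F}}$ the endpoint functions $f_\alpha^\pm:\mathbb{T}\to\mathbb{R}$ are given by $[f(s)]_\alpha=[f_\alpha^-(s),f_\alpha^+(s)]$. Addition $\oplus$ and scalar multiplication are levelwise. The Hukuhara difference $u\ominus_H v$ is the fuzzy number $w$, if it exists, with $u=v\oplus w$. The generalized Hukuhara difference $u\ominus_{gH}v$ is the fuzzy number $w$, if it exists, with $u=v\oplus w$ or $v=u\oplus(-1)w$. Metric: $D(u,v)=\sup_{\alpha\in[0,1]}\max\{|u_\alpha^--v_\alpha^-|,|u_\alpha^+-v_\alpha^+|\}$; continuity of $f$ is with respect to $D$. $\nabla_{gH}$-derivative: $f:\mathbb{T}\to\mathbb{R}_{\mathcal{F}}$ is $\nabla_{gH}$-differentiable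 at $t\in\mathbb{T}_\kappa$ with derivative $\nabla_{gH}f(t)\in\mathbb{R}_{\mathcal{F}}$ if for every $\varepsilon>0$ there is $\eta>0$ such that for all $0\le h<\eta$: if $t+h\in\mathbb{T}$ then $f(t+h)\ominus_{gH}f(\rho(t))$ exists and $D(f(t+h)\ominus_{gH}f(\rho(t)),\nabla_{gH}f(t)(h+\nu(t)))\le\varepsilon|h+\nu(t)|$; and if $t-h\in\mathbb{T}$ then $f(\rho(t))\ominus_{gH}f(t-h)$ exists and $D(f(\rho(t))\ominus_{gH}f(t-h),\nabla_{gH}f(t)(h-\nu(t)))\le\varepsilon|h-\nu(t)|$. *)

theory Defs
  imports "HOL-Analysis.Analysis"
begin

section \<open>Fuzzy numbers\<close>

definition fuzzy_number :: "(real \<Rightarrow> real) \<Rightarrow> bool" where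
  "fuzzy_number u \<longleftrightarrow>
     (\<forall>x. 0 \<le> u x \<and> u x \<le> 1) \<and>
     (\<exists>x. u x = 1) \<and>
     (\<forall>x y. \<forall>c\<in>{0..1}. u (c * x + (1 - c) * y) \<ge> min (u x) (u y)) \<and>
     (\<forall>x. \<forall>e>0. \<forall>\<^sub>F y in at x. u y < u x + e) \<and>
     compact (closure {x. u x > 0})"

lemma fuzzy_number_crisp: "fuzzy_number (\<lambda>x. if x = a then 1 else 0)"
proof -
  have usc: "\<forall>\<^sub>F y in at x. (if y = a then 1 else (0::real)) < (if x = a then 1 else 0) + e"
    if "e > 0" for x e :: real
  proof (cases "x = a")
    case True
    then show ?thesis using that by auto
  next
    case False
    then have "\<forall>\<^sub>F y in at x. y \<noteq> a"
      using tendsto_imp_eventually_ne tendsto_ident_at by blast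
    then show ?thesis by eventually_elim (use that in auto)
  qed
  have mid: "c * a + (1 - c) * a = a" for c
    by (simp add: algebra_simps)
  have "closure {x. (if x = a then 1 else (0::real)) > 0} = {a}"
    by (simp cong: if_cong)
  then show ?thesis
    unfolding fuzzy_number_def using usc mid by (auto simp: min_def)
qed

typedef fuzzy = "Collect fuzzy_number"
  morphisms membership Abs_fuzzy
  using fuzzy_number_crisp by auto

definition level :: "fuzzy \<Rightarrow> real \<Rightarrow> real set" where
  "level u \<alpha> = (if \<alpha> = 0 then closure {x. membership u x > 0} else {x. membership u x \<ge> \<alpha>})"

text \<open>On \<open>\<alpha> \<in> {0..1}\<close> the level sets are exactly \<open>{lower u \<alpha>..upper u \<alpha>}\<close>; see \<open>level_eq\<close> below.\<close>

definition lower :: "fuzzy \<Rightarrow> real \<Rightarrow> real" where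
  "lower u \<alpha> = Inf (level u \<alpha>)"

definition upper :: "fuzzy \<Rightarrow> real \<Rightarrow> real" where
  "upper u \<alpha> = Sup (level u \<alpha>)"

lemma fuzzy_number_membership: "fuzzy_number (membership u)"
  using membership by auto

lemma closed_membership_ge: "closed {x. membership u x \<ge> a}"
proof -
  have "open {x. membership u x < a}"
    unfolding open_dist
  proof safe
    fix x assume x: "membership u x < a"
    have "\<forall>\<^sub>F y in at x. membership u y < membership u x + (a - membership u x)"
      using fuzzy_number_membership[of u] x unfolding fuzzy_number_def
      by (metis diff_gt_0_iff_gt)
    then obtain d where "d > 0" "\<forall>y. y \<noteq> x \<and> dist y x < d \<longrightarrow> membership u y < a"
      unfolding eventually_at by auto
    then show "\<exists>e>0. \<forall>y. dist y x < e \<longrightarrow> y \<in> {x. membership u x < a}"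
      using x by (metis mem_Collect_eq)
  qed
  moreover have "- {x. membership u x \<ge> a} = {x. membership u x < a}" by auto
  ultimately show ?thesis by (simp add: closed_def)
qed

lemma level_subset_support: "0 \<le> \<alpha> \<Longrightarrow> level u \<alpha> \<subseteq> level u 0"
  unfolding level_def by (auto intro!: subsetD[OF closure_subset])

lemma compact_level:
  assumes "0 \<le> \<alpha>" shows "compact (level u \<alpha>)"
proof -
  have *: "compact (level u 0)"
    using fuzzy_number_membership[of u] by (simp add: level_def fuzzy_number_def)
  show ?thesis
  proof (cases "\<alpha> = 0")
    case False
    then have "closed (level u \<alpha>)"
      using closed_membership_ge by (simp add: level_def)
    then have "compact (level u 0 \<inter> level u \<alpha>)"
      using * by (rule compact_Int_closed[rotated])
    moreover have "level u 0 \<inter> level u \<alpha> = level u \<alpha>"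
      using level_subset_support[OF assms] by auto
    ultimately show ?thesis by simp
  qed (use * in auto)
qed

lemma level_nonempty:
  assumes "\<alpha> \<in> {0..1}" shows "level u \<alpha> \<noteq> {}"
proof -
  obtain x where "membership u x = 1"
    using fuzzy_number_membership[of u] by (auto simp: fuzzy_number_def)
  then have "x \<in> level u \<alpha>"
    using assms unfolding level_def by (auto intro!: subsetD[OF closure_subset])
  then show ?thesis by auto
qed

lemma convex_level: "convex (level u \<alpha>)"
proof -
  have qc: "min (membership u x) (membership u y) \<le> membership u (c * x + (1 - c) * y)"
    if "0 \<le> c" "c \<le> 1" for x y c
    using fuzzy_number_membership[of u] that by (auto simp: fuzzy_number_def)
  have ge: "convex {x. membership u x \<ge> a}" for a
    unfolding convex_alt
  proof (safe, simp)
    fix x y c assume "a \<le> membership u x" "a \<le> membership u y" "0 \<le> c" "c \<le> (1::real)"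
    then show "a \<le> membership u ((1 - c) * x + c * y)"
      using qc[of "1 - c" x y] by auto
  qed
  have gt: "convex {x. membership u x > a}" for a
    unfolding convex_alt
  proof (safe, simp)
    fix x y c assume "a < membership u x" "a < membership u y" "0 \<le> c" "c \<le> (1::real)"
    then show "a < membership u ((1 - c) * x + c * y)"
      using qc[of "1 - c" x y] by auto
  qed
  show ?thesis
    unfolding level_def using ge gt by (auto intro!: convex_closure)
qed

lemma compact_convex_real:
  fixes S :: "real set"
  assumes "compact S" "convex S" "S \<noteq> {}"
  shows "S = {Inf S..Sup S}" "Inf S \<le> Sup S"
proof -
  obtain a b where "S = {a..b}"
    using assms convex_connected connected_compact_interval_1 by metis
  then show "S = {Inf S..Sup S}" "Inf S \<le> Sup S" using assms(3) by auto
qed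

lemma level_eq:
  assumes "\<alpha> \<in> {0..1}"
  shows "level u \<alpha> = {lower u \<alpha>..upper u \<alpha>}" "lower u \<alpha> \<le> upper u \<alpha>"
  using compact_convex_real[OF compact_level convex_level level_nonempty[OF assms], of u] assms
  unfolding lower_def upper_def by auto

lemma fuzzy_eqI:
  assumes "\<And>\<alpha>. \<alpha> \<in> {0..1} \<Longrightarrow> level u \<alpha> = level v \<alpha>"
  shows "u = v"
proof -
  have b: "0 \<le> membership w x" "membership w x \<le> 1" for w x
    using fuzzy_number_membership[of w] by (auto simp: fuzzy_number_def)
  have "membership u x \<le> membership v x" if "\<And>\<alpha>. \<alpha> \<in> {0..1} \<Longrightarrow> level u \<alpha> = level v \<alpha>" for u v x
  proof (cases "membership u x = 0")
    case False
    then have "x \<in> level u (membership u x)" by (simp add: level_def)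
    then have "x \<in> level v (membership u x)" using that b by auto
    then show ?thesis using False by (simp add: level_def)
  qed (simp add: b)
  then have "membership u x = membership v x" for x
    using assms by (metis order_antisym)
  then show ?thesis using membership_inject by blast
qed

text \<open>Addition and scalar multiplication are determined by their level sets; that a fuzzy number
  with these level sets exists is shown in \<open>level_plus\<close> and \<open>level_scaleR\<close> below.\<close>

instantiation fuzzy :: "{plus, scaleR}"
begin

definition plus_fuzzy :: "fuzzy \<Rightarrow> fuzzy \<Rightarrow> fuzzy" where
  "u + v = (THE w. \<forall>\<alpha>\<in>{0..1}. level w \<alpha> = {x + y |x y. x \<in> level u \<alpha> \<and> y \<in> level v \<alpha>})"

definition scaleR_fuzzy :: "real \<Rightarrow> fuzzy \<Rightarrow> fuzzy" where
  "c *\<^sub>R u = (THE w. \<forall>\<alpha>\<in>{0..1}. level w \<alpha> = {c * x |x. x \<in> level u \<alpha>})"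

instance ..

end

lemma exists_fuzzy_of_levels:
  fixes K :: "real \<Rightarrow> 'a::euclidean_space set" and g :: "'a \<Rightarrow> real"
  assumes cK: "\<And>\<alpha>. 0 \<le> \<alpha> \<Longrightarrow> compact (K \<alpha>)"
    and nK: "\<And>\<alpha>. \<alpha> \<in> {0..1} \<Longrightarrow> K \<alpha> \<noteq> {}"
    and mono: "\<And>\<alpha> \<beta>. 0 \<le> \<alpha> \<Longrightarrow> \<alpha> \<le> \<beta> \<Longrightarrow> K \<beta> \<subseteq> K \<alpha>"
    and lcont: "\<And>\<alpha> x. 0 < \<alpha> \<Longrightarrow> (\<And>\<beta>. 0 < \<beta> \<Longrightarrow> \<beta> < \<alpha> \<Longrightarrow> x \<in> K \<beta>) \<Longrightarrow> x \<in> K \<alpha>"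
    and K0: "K 0 = closure (\<Union>\<alpha>\<in>{0<..1}. K \<alpha>)"
    and g: "continuous_on UNIV g"
    and conv: "\<And>\<alpha>. 0 \<le> \<alpha> \<Longrightarrow> convex (g ` K \<alpha>)"
  shows "\<exists>w. \<forall>\<alpha>\<in>{0..1}. level w \<alpha> = g ` K \<alpha>"
proof -
  define A where "A x = insert 0 {\<alpha>. 0 < \<alpha> \<and> \<alpha> \<le> 1 \<and> x \<in> g ` K \<alpha>}" for x
  define w where "w x = Sup (A x)" for x
  have bdd: "bdd_above (A x)" for x
    unfolding A_def by (rule bdd_aboveI[of _ 1]) auto
  have w01: "0 \<le> w x" "w x \<le> 1" for x
    unfolding w_def
    subgoal by (rule cSup_upper[OF _ bdd]) (simp add: A_def)
    subgoal by (rule cSup_least) (auto simp: A_def)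
    done
  have ge: "w x \<ge> \<alpha> \<longleftrightarrow> x \<in> g ` K \<alpha>" if \<alpha>: "0 < \<alpha>" "\<alpha> \<le> 1" for x \<alpha>
  proof
    assume "x \<in> g ` K \<alpha>"
    then show "w x \<ge> \<alpha>"
      unfolding w_def using \<alpha> by (intro cSup_upper bdd) (auto simp: A_def)
  next
    assume wx: "w x \<ge> \<alpha>"
    have below: "x \<in> g ` K \<beta>" if "0 < \<beta>" "\<beta> < \<alpha>" for \<beta>
    proof -
      have "\<beta> < Sup (A x)" using wx that by (simp add: w_def)
      then obtain \<gamma> where "\<gamma> \<in> A x" "\<beta> < \<gamma>"
        using less_cSup_iff[OF _ bdd] by (metis A_def insert_not_empty)
      then have "x \<in> g ` K \<gamma>" "\<beta> \<le> \<gamma>" using that by (auto simp: A_def)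
      then show ?thesis using mono[of \<beta> \<gamma>] that by auto
    qed
    define b where "b n = \<alpha> * (1 - 1 / (real n + 2))" for n :: nat
    have b: "0 < b n" "b n < \<alpha>" for n
      using \<alpha> by (auto simp: b_def field_simps add_pos_nonneg)
    have bmono: "b m \<le> b n" if "m \<le> n" for m n
      using \<alpha> that by (auto simp: b_def intro!: mult_left_mono frac_le)
    define F where "F n = K (b n) \<inter> g -` {x}" for n
    have "\<Inter>(range F) \<noteq> {}"
    proof (rule compact_nest)
      fix n
      have "closed (g -` {x})"
        using g by (simp add: continuous_on_closed_vimage)
      then show "compact (F n)"
        unfolding F_def using cK[of "b n"] b[of n] by (intro compact_Int_closed) auto
      show "F n \<noteq> {}" using below[OF b] unfolding F_def by auto
    next
      fix m n :: nat assume "m \<le> n"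
      then show "F n \<subseteq> F m"
        unfolding F_def using mono[OF _ bmono] b by (meson Int_mono less_imp_le subset_refl)
    qed
    then obtain z where z: "\<And>n. z \<in> F n" by auto
    have "z \<in> K \<alpha>"
    proof (rule lcont[OF \<alpha>(1)])
      fix \<beta> assume \<beta>: "0 < \<beta>" "\<beta> < \<alpha>"
      obtain n where n: "inverse (real (Suc n)) < 1 - \<beta> / \<alpha>"
        using reals_Archimedean[of "1 - \<beta> / \<alpha>"] \<beta> by (auto simp: field_simps)
      have "1 / (real n + 2) \<le> inverse (real (Suc n))"
        by (simp add: field_simps)
      then have "\<beta> / \<alpha> < 1 - 1 / (real n + 2)" using n by simp
      then have "\<beta> < b n" unfolding b_def using \<alpha> by (simp only: pos_divide_less_eq mult.commute)
      then show "z \<in> K \<beta>" using z[of n] mono[of \<beta> "b n"] \<beta> by (auto simp: F_def)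
    qed
    then show "x \<in> g ` K \<alpha>" using z[of 0] by (auto simp: F_def)
  qed
  have pos: "w x > 0 \<longleftrightarrow> (\<exists>\<alpha>\<in>{0<..1}. x \<in> g ` K \<alpha>)" for x
    using ge w01 by (metis greaterThanAtMost_iff less_le_trans order_refl)
  have cg: "compact (g ` K \<alpha>)" if "0 \<le> \<alpha>" for \<alpha>
    using compact_continuous_image[OF continuous_on_subset[OF g] cK[OF that]] by auto
  have supp: "closure {x. w x > 0} = g ` K 0"
  proof
    have "{x. w x > 0} \<subseteq> g ` K 0"
    proof
      fix x assume "x \<in> {x. w x > 0}"
      then obtain \<alpha> where "\<alpha> \<in> {0<..1}" "x \<in> g ` K \<alpha>" using pos by auto
      then show "x \<in> g ` K 0" using mono[of 0 \<alpha>] by auto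
    qed
    then show "closure {x. w x > 0} \<subseteq> g ` K 0"
      by (rule closure_minimal) (simp add: cg compact_imp_closed)
    have "g ` K 0 \<subseteq> closure (g ` (\<Union>\<alpha>\<in>{0<..1}. K \<alpha>))"
      unfolding K0 by (rule continuous_image_closure_subset[OF g]) simp
    also have "g ` (\<Union>\<alpha>\<in>{0<..1}. K \<alpha>) = {x. w x > 0}"
      using pos by (auto simp: image_UN)
    finally show "g ` K 0 \<subseteq> closure {x. w x > 0}" .
  qed
  have closed_ge: "closed {x. w x \<ge> a}" for a
  proof (cases "a \<le> 0")
    case True
    then have "{x. w x \<ge> a} = UNIV" using w01 order_trans by blast
    then show ?thesis by simp
  next
    case False
    show ?thesis
    proof (cases "a \<le> 1")
      case True
      then have "{x. w x \<ge> a} = g ` K a" using ge False by auto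
      then show ?thesis using cg[of a] False by (simp add: compact_imp_closed)
    next
      case False
      then have "{x. w x \<ge> a} = {}" using w01(2) by (auto simp: not_le intro: le_less_trans)
      then show ?thesis by (metis closed_empty)
    qed
  qed
  have "fuzzy_number w"
    unfolding fuzzy_number_def
  proof (intro conjI allI ballI impI)
    show "0 \<le> w x" "w x \<le> 1" for x by (fact w01)+
    obtain x where "x \<in> g ` K 1" using nK[of 1] by auto
    then have "w x = 1" using ge[of 1 x] w01(2)[of x] by simp
    then show "\<exists>x. w x = 1" ..
    show "min (w x) (w y) \<le> w (c * x + (1 - c) * y)" if "c \<in> {0..1}" for x y c
    proof (cases "min (w x) (w y) = 0")
      case False
      define m where "m = min (w x) (w y)"
      have m: "0 < m" "m \<le> 1" using False w01[of x] w01[of y] by (auto simp: m_def min_def)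
      have "x \<in> g ` K m" "y \<in> g ` K m" using ge[OF m, of x] ge[OF m, of y] by (simp_all add: m_def)
      then have "c *\<^sub>R x + (1 - c) *\<^sub>R y \<in> g ` K m"
        using conv[of m] that m by (intro convexD) auto
      then show ?thesis using ge[OF m] by (simp add: m_def)
    qed (simp add: w01)
    show "\<forall>\<^sub>F y in at x. w y < w x + e" if "0 < e" for x e
    proof -
      have "open (- {y. w y \<ge> w x + e})" using closed_ge by (rule open_Compl)
      moreover have "x \<in> - {y. w y \<ge> w x + e}" using that by simp
      ultimately have "\<forall>\<^sub>F y in at x. y \<in> - {y. w y \<ge> w x + e}"
        by (rule eventually_at_in_open')
      then show ?thesis by eventually_elim simp
    qed
    show "compact (closure {x. 0 < w x})" using supp cg by simp
  qed
  then have "membership (Abs_fuzzy w) = w" by (simp add: Abs_fuzzy_inverse)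
  then have "\<forall>\<alpha>\<in>{0..1}. level (Abs_fuzzy w) \<alpha> = g ` K \<alpha>"
    unfolding level_def using supp ge by auto
  then show ?thesis by blast
qed

lemma level_antimono: "0 \<le> \<alpha> \<Longrightarrow> \<alpha> \<le> \<beta> \<Longrightarrow> level u \<beta> \<subseteq> level u \<alpha>"
  using level_subset_support[of \<beta> u] by (cases "\<alpha> = 0") (auto simp: level_def)

lemma level_left_continuous:
  assumes "0 < \<alpha>" "\<And>\<beta>. 0 < \<beta> \<Longrightarrow> \<beta> < \<alpha> \<Longrightarrow> x \<in> level u \<beta>"
  shows "x \<in> level u \<alpha>"
proof -
  have "\<alpha> \<le> membership u x"
  proof (rule dense_le_bounded[OF assms(1)])
    fix \<beta> assume "0 < \<beta>" "\<beta> < \<alpha>"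
    then show "\<beta> \<le> membership u x" using assms(2)[of \<beta>] by (simp add: level_def)
  qed
  then show ?thesis using assms by (simp add: level_def)
qed

lemma support_eq: "{x. membership u x > 0} = (\<Union>\<alpha>\<in>{0<..1}. level u \<alpha>)"
proof -
  have "membership u x \<le> 1" for x
    using fuzzy_number_membership[of u] by (auto simp: fuzzy_number_def)
  then show ?thesis by (force simp: level_def)
qed

lemma level_plus:
  assumes "\<alpha> \<in> {0..1}"
  shows "level (u + v) \<alpha> = {x + y |x y. x \<in> level u \<alpha> \<and> y \<in> level v \<alpha>}"
proof -
  let ?g = "\<lambda>(x, y). x + y :: real" and ?K = "\<lambda>\<alpha>. level u \<alpha> \<times> level v \<alpha>"
  have im: "?g ` ?K a = {x + y |x y. x \<in> level u a \<and> y \<in> level v a}" for a by auto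
  have "\<exists>w. \<forall>\<alpha>\<in>{0..1}. level w \<alpha> = ?g ` ?K \<alpha>"
  proof (rule exists_fuzzy_of_levels)
    show "compact (?K a)" if "0 \<le> a" for a
      using that by (intro compact_Times compact_level)
    show "?K a \<noteq> {}" if "a \<in> {0..1}" for a
      using level_nonempty[OF that] by auto
    show "?K b \<subseteq> ?K a" if "0 \<le> a" "a \<le> b" for a b
      using level_antimono[OF that] by blast
    show "z \<in> ?K a" if "0 < a" "\<And>b. 0 < b \<Longrightarrow> b < a \<Longrightarrow> z \<in> ?K b" for a z
      using that level_left_continuous[OF that(1)] by (metis mem_Times_iff)
    have "(\<Union>a\<in>{0<..1}. ?K a) = (\<Union>a\<in>{0<..1}. level u a) \<times> (\<Union>a\<in>{0<..1}. level v a)"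
    proof safe
      fix x y a b
      assume a: "a \<in> {0<..1::real}" "x \<in> level u a" and b: "b \<in> {0<..1::real}" "y \<in> level v b"
      then have "(x, y) \<in> ?K (min a b)"
        using level_antimono[of "min a b" a u] level_antimono[of "min a b" b v] by auto
      then show "(x, y) \<in> (\<Union>a\<in>{0<..1}. ?K a)" using a b by (intro UN_I[of "min a b"]) auto
    qed blast+
    then show "?K 0 = closure (\<Union>a\<in>{0<..1}. ?K a)"
      unfolding support_eq[symmetric] by (simp add: closure_Times level_def)
    show "continuous_on UNIV ?g" by (auto simp: case_prod_beta intro!: continuous_intros)
    show "convex (?g ` ?K a)" for a
    proof -
      have "?g ` ?K a = (\<Union>x\<in>level u a. \<Union>y\<in>level v a. {x + y})" by auto
      then show ?thesis by (simp only: convex_sums convex_level)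
    qed
  qed
  then obtain w where w: "\<forall>a\<in>{0..1}. level w a = {x + y |x y. x \<in> level u a \<and> y \<in> level v a}"
    unfolding im by blast
  have "\<forall>a\<in>{0..1}. level (u + v) a = {x + y |x y. x \<in> level u a \<and> y \<in> level v a}"
    unfolding plus_fuzzy_def by (rule theI[of _ w]) (use w fuzzy_eqI in \<open>auto intro!: fuzzy_eqI\<close>)
  then show ?thesis using assms by blast
qed

lemma level_scaleR:
  assumes "\<alpha> \<in> {0..1}"
  shows "level (c *\<^sub>R u) \<alpha> = {c * x |x. x \<in> level u \<alpha>}"
proof -
  have im: "(*) c ` level u a = {c * x |x. x \<in> level u a}" for a by auto
  have "\<exists>w. \<forall>\<alpha>\<in>{0..1}. level w \<alpha> = (*) c ` level u \<alpha>"
  proof (rule exists_fuzzy_of_levels)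
    show "level u 0 = closure (\<Union>a\<in>{0<..1}. level u a)"
      unfolding support_eq[symmetric] by (simp add: level_def)
    show "convex ((*) c ` level u a)" for a
      using convex_scaling[OF convex_level, of c u a] by simp
  qed (use compact_level level_nonempty level_antimono level_left_continuous in
        \<open>auto intro!: continuous_intros\<close>)
  then obtain w where w: "\<forall>a\<in>{0..1}. level w a = {c * x |x. x \<in> level u a}"
    unfolding im by blast
  have "\<forall>a\<in>{0..1}. level (c *\<^sub>R u) a = {c * x |x. x \<in> level u a}"
    unfolding scaleR_fuzzy_def by (rule theI[of _ w]) (use w in \<open>auto intro!: fuzzy_eqI\<close>)
  then show ?thesis using assms by blast
qed

lemma lower_upper_plus:
  assumes "\<alpha> \<in> {0..1}"
  shows "lower (u + v) \<alpha> = lower u \<alpha> + lower v \<alpha>" "upper (u + v) \<alpha> = upper u \<alpha> + upper v \<alpha>"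
proof -
  note l = level_eq[OF assms]
  have "{lower (u + v) \<alpha>..upper (u + v) \<alpha>} = {lower u \<alpha> + lower v \<alpha>..upper u \<alpha> + upper v \<alpha>}"
    unfolding l(1)[symmetric] level_plus[OF assms] unfolding l(1)[of u] l(1)[of v]
  proof safe
    fix z assume z: "z \<in> {lower u \<alpha> + lower v \<alpha>..upper u \<alpha> + upper v \<alpha>}"
    show "\<exists>x y. z = x + y \<and> x \<in> {lower u \<alpha>..upper u \<alpha>} \<and> y \<in> {lower v \<alpha>..upper v \<alpha>}"
      using z l(2)[of u] l(2)[of v]
      by (intro exI[of _ "max (lower u \<alpha>) (z - upper v \<alpha>)"]
                exI[of _ "z - max (lower u \<alpha>) (z - upper v \<alpha>)"]) (auto simp: max_def)
  qed auto
  then show "lower (u + v) \<alpha> = lower u \<alpha> + lower v \<alpha>" "upper (u + v) \<alpha> = upper u \<alpha> + upper v \<alpha>"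
    using l(2)[of "u + v"] by (auto simp: Icc_eq_Icc)
qed

lemma lower_upper_uminus:
  assumes "\<alpha> \<in> {0..1}"
  shows "lower ((- 1) *\<^sub>R u) \<alpha> = - upper u \<alpha>" "upper ((- 1) *\<^sub>R u) \<alpha> = - lower u \<alpha>"
proof -
  note l = level_eq[OF assms]
  have "{lower ((- 1) *\<^sub>R u) \<alpha>..upper ((- 1) *\<^sub>R u) \<alpha>} = {- upper u \<alpha>..- lower u \<alpha>}"
    unfolding l(1)[symmetric] level_scaleR[OF assms] unfolding l(1)[of u]
  proof safe
    fix z assume "z \<in> {- upper u \<alpha>..- lower u \<alpha>}"
    then show "\<exists>x. z = - 1 * x \<and> x \<in> {lower u \<alpha>..upper u \<alpha>}"
      by (intro exI[of _ "- z"]) auto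
  qed auto
  then show "lower ((- 1) *\<^sub>R u) \<alpha> = - upper u \<alpha>" "upper ((- 1) *\<^sub>R u) \<alpha> = - lower u \<alpha>"
    using l(2)[of "(- 1) *\<^sub>R u"] by (auto simp: Icc_eq_Icc)
qed

lemma fuzzy_eqI_endpoints:
  assumes "\<And>\<alpha>. \<alpha> \<in> {0..1} \<Longrightarrow> lower u \<alpha> = lower v \<alpha>"
    and "\<And>\<alpha>. \<alpha> \<in> {0..1} \<Longrightarrow> upper u \<alpha> = upper v \<alpha>"
  shows "u = v"
  using assms by (intro fuzzy_eqI) (simp add: level_eq)

subsection \<open>Hukuhara differences\<close>

definition H_diff_exists :: "fuzzy \<Rightarrow> fuzzy \<Rightarrow> bool" where
  "H_diff_exists u v \<longleftrightarrow> (\<exists>w. u = v + w)"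

definition is_gH_diff :: "fuzzy \<Rightarrow> fuzzy \<Rightarrow> fuzzy \<Rightarrow> bool" where
  "is_gH_diff u v w \<longleftrightarrow> u = v + w \<or> v = u + (- 1) *\<^sub>R w"

definition gH_diff_exists :: "fuzzy \<Rightarrow> fuzzy \<Rightarrow> bool" where
  "gH_diff_exists u v \<longleftrightarrow> (\<exists>w. is_gH_diff u v w)"

definition gH_diff :: "fuzzy \<Rightarrow> fuzzy \<Rightarrow> fuzzy" (infixl \<open>\<ominus>\<^sub>g\<^sub>H\<close> 65) where
  "u \<ominus>\<^sub>g\<^sub>H v = (THE w. is_gH_diff u v w)"

lemma is_gH_diff_unique:
  assumes "is_gH_diff u v w" "is_gH_diff u v w'"
  shows "w = w'"
proof (rule fuzzy_eqI_endpoints)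
  fix \<alpha> :: real assume \<alpha>: "\<alpha> \<in> {0..1}"
  have e: "(lower u \<alpha> = lower v \<alpha> + lower z \<alpha> \<and> upper u \<alpha> = upper v \<alpha> + upper z \<alpha>) \<or>
           (lower v \<alpha> = lower u \<alpha> - upper z \<alpha> \<and> upper v \<alpha> = upper u \<alpha> - lower z \<alpha>)"
    if "is_gH_diff u v z" for z
    using that lower_upper_plus[OF \<alpha>] lower_upper_uminus[OF \<alpha>] unfolding is_gH_diff_def
    by (metis add_uminus_conv_diff)
  show "lower w \<alpha> = lower w' \<alpha>" "upper w \<alpha> = upper w' \<alpha>"
    using e[OF assms(1)] e[OF assms(2)] level_eq(2)[OF \<alpha>, of w] level_eq(2)[OF \<alpha>, of w']
    by linarith+
qed

lemma gH_diff_eq: "is_gH_diff u v w \<Longrightarrow> u \<ominus>\<^sub>g\<^sub>H v = w"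
  unfolding gH_diff_def using is_gH_diff_unique by blast

subsection \<open>The supremum metric\<close>

instantiation fuzzy :: metric_space
begin

definition dist_fuzzy :: "fuzzy \<Rightarrow> fuzzy \<Rightarrow> real" where
  "dist u v = (SUP \<alpha>\<in>{0..1}. max \<bar>lower u \<alpha> - lower v \<alpha>\<bar> \<bar>upper u \<alpha> - upper v \<alpha>\<bar>)"

definition uniformity_fuzzy :: "(fuzzy \<times> fuzzy) filter" where
  "uniformity_fuzzy = (INF e\<in>{0<..}. principal {(u, v). dist u v < e})"

definition open_fuzzy :: "fuzzy set \<Rightarrow> bool" where
  "open_fuzzy U \<longleftrightarrow> (\<forall>x\<in>U. \<forall>\<^sub>F (x', y) in uniformity. x' = x \<longrightarrow> y \<in> U)"

lemma endpoints_in_support: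
  assumes "\<alpha> \<in> {0..1}"
  shows "lower u 0 \<le> lower u \<alpha>" "upper u \<alpha> \<le> upper u 0"
proof -
  have "{lower u \<alpha>..upper u \<alpha>} \<subseteq> {lower u 0..upper u 0}"
    using level_subset_support[of \<alpha> u] level_eq(1)[OF assms] level_eq(1)[of 0] assms by simp
  then show "lower u 0 \<le> lower u \<alpha>" "upper u \<alpha> \<le> upper u 0"
    using level_eq(2)[OF assms] by auto
qed

lemma bdd_above_dist_fuzzy:
  "bdd_above ((\<lambda>\<alpha>. max \<bar>lower u \<alpha> - lower v \<alpha>\<bar> \<bar>upper u \<alpha> - upper v \<alpha>\<bar>) ` {0..1})"
proof (rule bdd_aboveI2)
  fix \<alpha> :: real assume \<alpha>: "\<alpha> \<in> {0..1}"
  show "max \<bar>lower u \<alpha> - lower v \<alpha>\<bar> \<bar>upper u \<alpha> - upper v \<alpha>\<bar> \<le>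
          \<bar>upper u 0 - lower v 0\<bar> + \<bar>upper v 0 - lower u 0\<bar>"
    using endpoints_in_support[OF \<alpha>, of u] endpoints_in_support[OF \<alpha>, of v]
      level_eq(2)[OF \<alpha>, of u] level_eq(2)[OF \<alpha>, of v] by linarith
qed

lemma endpoint_dist_le:
  assumes "\<alpha> \<in> {0..1}"
  shows "\<bar>lower u \<alpha> - lower v \<alpha>\<bar> \<le> dist u v" "\<bar>upper u \<alpha> - upper v \<alpha>\<bar> \<le> dist u v"
  using cSUP_upper[OF assms bdd_above_dist_fuzzy[of u v]] by (auto simp: dist_fuzzy_def)

lemma dist_fuzzy_le:
  assumes "\<And>\<alpha>. \<alpha> \<in> {0..1} \<Longrightarrow> \<bar>lower u \<alpha> - lower v \<alpha>\<bar> \<le> d"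
    and "\<And>\<alpha>. \<alpha> \<in> {0..1} \<Longrightarrow> \<bar>upper u \<alpha> - upper v \<alpha>\<bar> \<le> d"
  shows "dist u v \<le> d"
  unfolding dist_fuzzy_def using assms by (intro cSUP_least) auto

instance
proof
  fix u v w :: fuzzy and U :: "fuzzy set"
  show "uniformity = (INF e\<in>{0<..}. principal {(u, v :: fuzzy). dist u v < e})"
    by (rule uniformity_fuzzy_def)
  show "open U \<longleftrightarrow> (\<forall>x\<in>U. \<forall>\<^sub>F (x', y) in uniformity. x' = x \<longrightarrow> y \<in> U)"
    by (rule open_fuzzy_def)
  show "dist u v = 0 \<longleftrightarrow> u = v"
  proof
    assume "dist u v = 0"
    then show "u = v"
      using endpoint_dist_le[of _ u v] by (intro fuzzy_eqI_endpoints) fastforce+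
  qed (simp add: dist_fuzzy_def)
  show "dist u v \<le> dist u w + dist v w"
  proof (rule dist_fuzzy_le)
    fix \<alpha> :: real assume "\<alpha> \<in> {0..1}"
    then show "\<bar>lower u \<alpha> - lower v \<alpha>\<bar> \<le> dist u w + dist v w"
      "\<bar>upper u \<alpha> - upper v \<alpha>\<bar> \<le> dist u w + dist v w"
      using endpoint_dist_le[of \<alpha> u w] endpoint_dist_le[of \<alpha> v w] by linarith+
  qed
qed

end

section \<open>Time scales\<close>

definition time_scale :: "real set \<Rightarrow> bool" where
  "time_scale T \<longleftrightarrow> T \<noteq> {} \<and> closed T"

text \<open>\<open>Sup T\<close> (\<open>Inf T\<close>) is only evaluated when \<open>T\<close> has no point above (below) \<open>t\<close>, so that
  \<open>T\<close> is bounded on that side.\<close>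

definition forward_jump :: "real set \<Rightarrow> real \<Rightarrow> real" where
  "forward_jump T t = (if \<exists>s\<in>T. s > t then Inf {s\<in>T. s > t} else Sup T)"

definition backward_jump :: "real set \<Rightarrow> real \<Rightarrow> real" where
  "backward_jump T t = (if \<exists>s\<in>T. s < t then Sup {s\<in>T. s < t} else Inf T)"

definition left_scattered :: "real set \<Rightarrow> real \<Rightarrow> bool" where
  "left_scattered T t \<longleftrightarrow> backward_jump T t < t"

definition right_scattered :: "real set \<Rightarrow> real \<Rightarrow> bool" where
  "right_scattered T t \<longleftrightarrow> forward_jump T t > t"

definition T_kappa :: "real set \<Rightarrow> real set" where
  "T_kappa T = T - {m\<in>T. (\<forall>s\<in>T. m \<le> s) \<and> right_scattered T m}"

definition graininess :: "real set \<Rightarrow> real \<Rightarrow> real" where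
  "graininess T t = t - backward_jump T t"

section \<open>Nabla derivatives\<close>

text \<open>Derivatives are relations, so that the one-point time scale, where every number is a
  derivative, needs no convention. For \<open>t \<in> T_kappa T\<close> in any other time scale they are unique.\<close>

definition nabla_bound_on ::
    "real set \<Rightarrow> (real \<Rightarrow> real) \<Rightarrow> real \<Rightarrow> real \<Rightarrow> real \<Rightarrow> real set \<Rightarrow> bool" where
  "nabla_bound_on T \<phi> d t \<epsilon> U \<longleftrightarrow>
     (\<forall>s\<in>U. \<bar>\<phi> (backward_jump T t) - \<phi> s - d * (backward_jump T t - s)\<bar> \<le> \<epsilon> * \<bar>backward_jump T t - s\<bar>)"

definition nbhd_in :: "real set \<Rightarrow> real \<Rightarrow> real set \<Rightarrow> bool" where
  "nbhd_in T t U \<longleftrightarrow> openin (top_of_set T) U \<and> t \<in> U"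

definition has_nabla_derivative :: "real set \<Rightarrow> (real \<Rightarrow> real) \<Rightarrow> real \<Rightarrow> real \<Rightarrow> bool" where
  "has_nabla_derivative T \<phi> d t \<longleftrightarrow> (\<forall>\<epsilon>>0. \<exists>U. nbhd_in T t U \<and> nabla_bound_on T \<phi> d t \<epsilon> U)"

text \<open>The family \<open>\<phi> \<alpha>\<close>, \<open>\<alpha> \<in> {0..1}\<close>, with derivatives \<open>d \<alpha>\<close>: the neighbourhood does not depend
  on \<open>\<alpha>\<close>.\<close>

definition has_nabla_derivative_uniformly ::
    "real set \<Rightarrow> (real \<Rightarrow> real \<Rightarrow> real) \<Rightarrow> (real \<Rightarrow> real) \<Rightarrow> real \<Rightarrow> bool" where
  "has_nabla_derivative_uniformly T \<phi> d t \<longleftrightarrow>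
     (\<forall>\<alpha>\<in>{0..1}. has_nabla_derivative T (\<phi> \<alpha>) (d \<alpha>) t) \<and>
     (\<forall>\<epsilon>>0. \<exists>U. nbhd_in T t U \<and> (\<forall>\<alpha>\<in>{0..1}. nabla_bound_on T (\<phi> \<alpha>) (d \<alpha>) t \<epsilon> U))"

text \<open>One-sided derivatives. The set \<open>H\<close> of admissible signs of the increment is \<open>{0<..}\<close> for the
  right and \<open>{..<0}\<close> for the left derivative.\<close>

definition nabla_quotient :: "real set \<Rightarrow> (real \<Rightarrow> real) \<Rightarrow> real \<Rightarrow> real \<Rightarrow> real" where
  "nabla_quotient T \<phi> t h = (\<phi> (t + h) - \<phi> (backward_jump T t)) / (h + graininess T t)"

definition increments :: "real set \<Rightarrow> real set \<Rightarrow> real \<Rightarrow> real set" where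
  "increments H T t = {h\<in>H. t + h \<in> T}"

definition has_onesided_nabla ::
    "real set \<Rightarrow> real set \<Rightarrow> (real \<Rightarrow> real) \<Rightarrow> real \<Rightarrow> real \<Rightarrow> bool" where
  "has_onesided_nabla H T \<phi> d t \<longleftrightarrow>
     (if 0 islimpt increments H T t
      then (nabla_quotient T \<phi> t \<longlongrightarrow> d) (at 0 within increments H T t)
      else left_scattered T t \<and> d = (\<phi> t - \<phi> (backward_jump T t)) / graininess T t)"

text \<open>Off limit points no limit is taken, so uniformity has content only in the limit case.\<close>

definition has_onesided_nabla_uniformly ::
    "real set \<Rightarrow> real set \<Rightarrow> (real \<Rightarrow> real \<Rightarrow> real) \<Rightarrow> (real \<Rightarrow> real) \<Rightarrow> real \<Rightarrow> bool" where
  "has_onesided_nabla_uniformly H T \<phi> d t \<longleftrightarrow>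
     (\<forall>\<alpha>\<in>{0..1}. has_onesided_nabla H T (\<phi> \<alpha>) (d \<alpha>) t) \<and>
     (0 islimpt increments H T t \<longrightarrow>
        uniform_limit {0..1} (\<lambda>h \<alpha>. nabla_quotient T (\<phi> \<alpha>) t h) d (at 0 within increments H T t))"

abbreviation has_right_nabla_uniformly ::
    "real set \<Rightarrow> (real \<Rightarrow> real \<Rightarrow> real) \<Rightarrow> (real \<Rightarrow> real) \<Rightarrow> real \<Rightarrow> bool" where
  "has_right_nabla_uniformly \<equiv> has_onesided_nabla_uniformly {0<..}"

abbreviation has_left_nabla_uniformly ::
    "real set \<Rightarrow> (real \<Rightarrow> real \<Rightarrow> real) \<Rightarrow> (real \<Rightarrow> real) \<Rightarrow> real \<Rightarrow> bool" where
  "has_left_nabla_uniformly \<equiv> has_onesided_nabla_uniformly {..<0}"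

definition has_nabla_gH_derivative :: "real set \<Rightarrow> (real \<Rightarrow> fuzzy) \<Rightarrow> fuzzy \<Rightarrow> real \<Rightarrow> bool" where
  "has_nabla_gH_derivative T f F t \<longleftrightarrow>
     (\<forall>\<epsilon>>0. \<exists>\<eta>>0. \<forall>h. 0 \<le> h \<and> h < \<eta> \<longrightarrow>
        (t + h \<in> T \<longrightarrow>
           gH_diff_exists (f (t + h)) (f (backward_jump T t)) \<and>
           dist (f (t + h) \<ominus>\<^sub>g\<^sub>H f (backward_jump T t)) ((h + graininess T t) *\<^sub>R F)
             \<le> \<epsilon> * \<bar>h + graininess T t\<bar>) \<and>
        (t - h \<in> T \<longrightarrow>
           gH_diff_exists (f (backward_jump T t)) (f (t - h)) \<and>
           dist (f (backward_jump T t) \<ominus>\<^sub>g\<^sub>H f (t - h)) ((h - graininess T t) *\<^sub>R F)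
             \<le> \<epsilon> * \<bar>h - graininess T t\<bar>))"

end

theory Submission
  imports Defs
begin

text \<open>At a left-scattered point the generalized Hukuhara difference \<open>f t \<ominus>\<^sub>g\<^sub>H f (backward_jump T t)\<close> is
  exactly \<open>graininess T t *\<^sub>R F\<close>, and continuity at \<open>t\<close> extends its endpoint relation to a neighbourhood;
  this is case (i).

  If \<open>backward_jump T t = t\<close>, the difference quotients of the two endpoint functions at a nearby \<open>s\<close>
  approximate the endpoints of \<open>F\<close> uniformly in the level, either in order or swapped, but the choice
  may depend on \<open>s\<close>. When \<open>F\<close> is not crisp, the choice is read off from the sign of the change of
  the width of the support of \<open>f\<close> between \<open>t\<close> and \<open>s\<close>. That change does not vanish near \<open>t\<close>, so on
  each side of \<open>t\<close> it can change sign only by jumping across a gap of the time scale, and the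
  Hukuhara differences assumed at left-scattered points forbid such a jump. Hence the choice is
  constant on each side: equal choices give case (i), different ones case (ii).\<close>

section \<open>Nabla estimates at single points, uniform in the level\<close>

text \<open>Testing one point \<open>s\<close> for all levels at once lets neighbourhoods be
  replaced by filters; uniformity in the level is kept because the quantifier over levels stands
  inside the filter.\<close>

definition nabla_near ::
    "real set \<Rightarrow> (real \<Rightarrow> real \<Rightarrow> real) \<Rightarrow> (real \<Rightarrow> real) \<Rightarrow> real \<Rightarrow> real \<Rightarrow> real \<Rightarrow> bool" where
  "nabla_near T \<phi> d t \<epsilon> s \<longleftrightarrow> (\<forall>\<alpha>\<in>{0..1}. nabla_bound_on T (\<phi> \<alpha>) (d \<alpha>) t \<epsilon> {s})"

text \<open>The slopes \<open>l\<close> and \<open>u\<close> are not assumed to be ordered: they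
  stand for \<open>lower F\<close> and \<open>upper F\<close> in either order.\<close>

definition endpoints_near ::
    "real set \<Rightarrow> (real \<Rightarrow> fuzzy) \<Rightarrow> (real \<Rightarrow> real) \<Rightarrow> (real \<Rightarrow> real) \<Rightarrow> real \<Rightarrow> real \<Rightarrow> real \<Rightarrow> bool" where
  "endpoints_near T f l u t \<epsilon> s \<longleftrightarrow>
     nabla_near T (\<lambda>\<alpha> s. lower (f s) \<alpha>) l t \<epsilon> s \<and> nabla_near T (\<lambda>\<alpha> s. upper (f s) \<alpha>) u t \<epsilon> s"

lemma nabla_near_mono: "nabla_near T \<phi> d t \<epsilon> s \<Longrightarrow> \<epsilon> \<le> \<epsilon>' \<Longrightarrow> nabla_near T \<phi> d t \<epsilon>' s"
  unfolding nabla_near_def nabla_bound_on_def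
  by (meson abs_ge_zero mult_right_mono order_trans)

lemma endpoints_near_mono:
  "endpoints_near T f l u t \<epsilon> s \<Longrightarrow> \<epsilon> \<le> \<epsilon>' \<Longrightarrow> endpoints_near T f l u t \<epsilon>' s"
  unfolding endpoints_near_def using nabla_near_mono by blast

lemma nabla_near_left_dense:
  assumes "backward_jump T t = t" shows "nabla_near T \<phi> d t \<epsilon> t"
  using assms by (simp add: nabla_near_def nabla_bound_on_def)

text \<open>The filter \<open>at t within T\<close> ignores \<open>t\<close>, where the estimate is
  a genuine condition if \<open>t\<close> is left-scattered; hence the separate assumption
  there.\<close>

lemma has_nabla_derivative_uniformlyI:
  assumes "t \<in> T" and "\<And>\<epsilon>. \<epsilon> > 0 \<Longrightarrow> nabla_near T \<phi> d t \<epsilon> t"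
    and "\<And>\<epsilon>. \<epsilon> > 0 \<Longrightarrow> \<forall>\<^sub>F s in at t within T. nabla_near T \<phi> d t \<epsilon> s"
  shows "has_nabla_derivative_uniformly T \<phi> d t"
proof -
  have "\<exists>U. nbhd_in T t U \<and> (\<forall>\<alpha>\<in>{0..1}. nabla_bound_on T (\<phi> \<alpha>) (d \<alpha>) t \<epsilon> U)" if pos: "\<epsilon> > 0" for \<epsilon>
  proof -
    obtain \<eta> where \<eta>: "\<eta> > 0" "\<And>s. s \<in> T \<Longrightarrow> s \<noteq> t \<Longrightarrow> dist s t < \<eta> \<Longrightarrow> nabla_near T \<phi> d t \<epsilon> s"
      using assms(3)[OF pos] unfolding eventually_at by blast
    have "nabla_near T \<phi> d t \<epsilon> s" if "s \<in> T \<inter> ball t \<eta>" for s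
      using \<eta>(2)[of s] assms(2)[OF pos] that by (cases "s = t") (auto simp: dist_commute)
    then have "\<forall>\<alpha>\<in>{0..1}. nabla_bound_on T (\<phi> \<alpha>) (d \<alpha>) t \<epsilon> (T \<inter> ball t \<eta>)"
      unfolding nabla_near_def nabla_bound_on_def by blast
    moreover have "nbhd_in T t (T \<inter> ball t \<eta>)"
      using assms(1) \<eta>(1) by (auto simp: nbhd_in_def openin_open)
    ultimately show ?thesis by blast
  qed
  then show ?thesis
    unfolding has_nabla_derivative_uniformly_def has_nabla_derivative_def by blast
qed

section \<open>One-sided derivatives as limits over points of the time scale\<close>

text \<open>Translation by \<open>t\<close> identifies the increments \<open>h\<close> tending to 0
  with the points \<open>s\<close> of \<open>T\<close> tending to \<open>t\<close> from the side
  given by \<open>H\<close>.\<close>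

lemma eventually_at_increments:
  "(\<forall>\<^sub>F h in at 0 within increments H T t. P (t + h)) \<longleftrightarrow>
     (\<forall>\<^sub>F s in at t within T \<inter> (+) t ` H. P s)"
proof -
  have "at t within T \<inter> (+) t ` H = filtermap ((+) t) (at 0 within increments H T t)"
  proof (rule filter_eqI)
    fix P
    have "(\<exists>d>0. \<forall>x\<in>T \<inter> (+) t ` H. x \<noteq> t \<and> dist x t < d \<longrightarrow> P x) \<longleftrightarrow>
        (\<exists>d>0. \<forall>x\<in>increments H T t. x \<noteq> 0 \<and> dist x 0 < d \<longrightarrow> P (t + x))"
    proof (intro iff_exI conj_cong refl iffI ballI impI)
      fix d x
      assume d: "\<forall>x\<in>T \<inter> (+) t ` H. x \<noteq> t \<and> dist x t < d \<longrightarrow> P x"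
        and "x \<in> increments H T t" "x \<noteq> 0 \<and> dist x 0 < d"
      then show "P (t + x)"
        using bspec[OF d, of "t + x"] by (simp add: increments_def dist_real_def)
    next
      fix d x
      assume d: "\<forall>x\<in>increments H T t. x \<noteq> 0 \<and> dist x 0 < d \<longrightarrow> P (t + x)"
        and "x \<in> T \<inter> (+) t ` H" "x \<noteq> t \<and> dist x t < d"
      then show "P x"
        using bspec[OF d, of "x - t"] by (auto simp: increments_def dist_real_def)
    qed
    then show "(\<forall>\<^sub>F s in at t within T \<inter> (+) t ` H. P s) \<longleftrightarrow>
        (\<forall>\<^sub>F s in filtermap ((+) t) (at 0 within increments H T t). P s)"
      by (simp add: eventually_filtermap eventually_at)
  qed
  then show ?thesis by (simp add: eventually_filtermap)
qed

lemma islimpt_increments: "0 islimpt increments H T t \<longleftrightarrow> t islimpt T \<inter> (+) t ` H"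
  using eventually_at_increments[where P = "\<lambda>_. False", of H T t]
  by (metis eventually_False trivial_limit_within)

text \<open>The graininess vanishes here, so division by the absolute value of \<open>h\<close>
  turns the estimate into closeness of the quotient to \<open>d\<close>, uniformly in the
  level.\<close>

lemma has_onesided_nabla_uniformlyI:
  assumes "backward_jump T t = t" "0 \<notin> H" "t islimpt T \<inter> (+) t ` H"
    and "\<And>\<epsilon>. \<epsilon> > 0 \<Longrightarrow> \<forall>\<^sub>F s in at t within T \<inter> (+) t ` H. nabla_near T \<phi> d t \<epsilon> s"
  shows "has_onesided_nabla_uniformly H T \<phi> d t"
proof -
  have lim: "0 islimpt increments H T t"
    using assms(3) by (simp add: islimpt_increments)
  have u: "uniform_limit {0..1} (\<lambda>h \<alpha>. nabla_quotient T (\<phi> \<alpha>) t h) d (at 0 within increments H T t)"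
  proof (rule uniform_limitI)
    fix e :: real assume "e > 0"
    \<comment> \<open>Halving \<open>e\<close> turns the weak estimate into the strict inequality of
      a uniform limit.\<close>
    then have "\<forall>\<^sub>F h in at 0 within increments H T t. nabla_near T \<phi> d t (e / 2) (t + h)"
      using assms(4)[of "e / 2"] by (simp add: eventually_at_increments)
    moreover have "\<forall>\<^sub>F h in at 0 within increments H T t. h \<noteq> 0"
      by (simp add: eventually_at_filter)
    ultimately show "\<forall>\<^sub>F h in at 0 within increments H T t.
        \<forall>\<alpha>\<in>{0..1}. dist (nabla_quotient T (\<phi> \<alpha>) t h) (d \<alpha>) < e"
    proof eventually_elim
      case (elim h)
      show ?case
      proof
        fix \<alpha> :: real assume "\<alpha> \<in> {0..1}"
        then have "\<bar>\<phi> \<alpha> t - \<phi> \<alpha> (t + h) + d \<alpha> * h\<bar> \<le> e / 2 * \<bar>h\<bar>"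
          using elim(1) assms(1) by (simp add: nabla_near_def nabla_bound_on_def)
        moreover have "\<bar>(\<phi> \<alpha> (t + h) - \<phi> \<alpha> t) / h - d \<alpha>\<bar> = \<bar>\<phi> \<alpha> t - \<phi> \<alpha> (t + h) + d \<alpha> * h\<bar> / \<bar>h\<bar>"
          using elim(2) by (simp add: abs_minus_commute field_simps flip: abs_divide)
        ultimately have "\<bar>(\<phi> \<alpha> (t + h) - \<phi> \<alpha> t) / h - d \<alpha>\<bar> \<le> e / 2"
          using elim(2) by (simp add: pos_divide_le_eq)
        then show "dist (nabla_quotient T (\<phi> \<alpha>) t h) (d \<alpha>) < e"
          using assms(1) \<open>e > 0\<close> by (simp add: nabla_quotient_def graininess_def dist_real_def)
      qed
    qed
  qed
  then show ?thesis
    unfolding has_onesided_nabla_uniformly_def has_onesided_nabla_def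
    using lim tendsto_uniform_limitI[OF u] by auto
qed

section \<open>Endpoints of generalized Hukuhara differences\<close>

lemma lower_upper_scaleR:
  assumes "\<alpha> \<in> {0..1}" "0 \<le> c"
  shows "lower (c *\<^sub>R u) \<alpha> = c * lower u \<alpha>" "upper (c *\<^sub>R u) \<alpha> = c * upper u \<alpha>"
proof -
  have "level (c *\<^sub>R u) \<alpha> = (*) c ` {lower u \<alpha>..upper u \<alpha>}"
    using level_scaleR[OF assms(1), of c u] level_eq(1)[OF assms(1), of u] by auto
  also have "\<dots> = {c * lower u \<alpha>..c * upper u \<alpha>}"
    using assms(2) level_eq(2)[OF assms(1), of u] by (simp add: image_mult_atLeastAtMost_if)
  finally show "lower (c *\<^sub>R u) \<alpha> = c * lower u \<alpha>" "upper (c *\<^sub>R u) \<alpha> = c * upper u \<alpha>"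
    using level_eq[OF assms(1), of "c *\<^sub>R u"] by (auto simp: Icc_eq_Icc)
qed

text \<open>The disjuncts are the two ways in which the difference \<open>w\<close> can arise. In
  \<open>v = u + (- 1) *\<^sub>R w\<close> the factor exchanges the endpoints of \<open>w\<close>.
  The choice is made between fuzzy numbers, hence for all levels at once.\<close>

lemma gH_diff_near_scaleR:
  assumes "gH_diff_exists u v" "dist (u \<ominus>\<^sub>g\<^sub>H v) (c *\<^sub>R F) \<le> e" "0 \<le> c"
  shows "(\<forall>\<alpha>\<in>{0..1}. \<bar>lower u \<alpha> - lower v \<alpha> - c * lower F \<alpha>\<bar> \<le> e \<and>
                    \<bar>upper u \<alpha> - upper v \<alpha> - c * upper F \<alpha>\<bar> \<le> e) \<or>
         (\<forall>\<alpha>\<in>{0..1}. \<bar>lower u \<alpha> - lower v \<alpha> - c * upper F \<alpha>\<bar> \<le> e \<and>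
                    \<bar>upper u \<alpha> - upper v \<alpha> - c * lower F \<alpha>\<bar> \<le> e)"
proof -
  obtain w where w: "is_gH_diff u v w"
    using assms(1) by (auto simp: gH_diff_exists_def)
  have near: "\<bar>lower w \<alpha> - c * lower F \<alpha>\<bar> \<le> e" "\<bar>upper w \<alpha> - c * upper F \<alpha>\<bar> \<le> e"
    if "\<alpha> \<in> {0..1}" for \<alpha>
    using endpoint_dist_le[OF that, of w "c *\<^sub>R F"] assms(2)
      lower_upper_scaleR[OF that assms(3), of F] gH_diff_eq[OF w] by auto
  from w consider "u = v + w" | "v = u + (- 1) *\<^sub>R w"
    by (auto simp: is_gH_diff_def)
  then show ?thesis
  proof cases
    case 1
    then show ?thesis using near lower_upper_plus[of _ v w] by simp
  next
    case 2
    have "lower v \<alpha> = lower u \<alpha> - upper w \<alpha>" "upper v \<alpha> = upper u \<alpha> - lower w \<alpha>"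
      if "\<alpha> \<in> {0..1}" for \<alpha>
      using 2 lower_upper_plus[OF that, of u "(- 1) *\<^sub>R w"] lower_upper_uminus[OF that, of w] by auto
    then show ?thesis using near by simp
  qed
qed

section \<open>Jumps and sign changes on a time scale\<close>

lemma backward_jump_gap:
  assumes "a \<in> T" "a < b" "\<And>x. x \<in> T \<Longrightarrow> a < x \<Longrightarrow> b \<le> x"
  shows "backward_jump T b = a"
proof -
  have "Sup {s \<in> T. s < b} = a"
  proof (rule cSup_eq_maximum)
    show "a \<in> {s \<in> T. s < b}" using assms by simp
    show "x \<le> a" if "x \<in> {s \<in> T. s < b}" for x
      using assms(3)[of x] that by (cases "a < x") auto
  qed
  then show ?thesis using assms(1,2) by (auto simp: backward_jump_def)
qed

lemma backward_jump_le: "t \<in> T \<Longrightarrow> backward_jump T t \<le> t"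
  unfolding backward_jump_def
  by (auto intro!: cSup_least cInf_lower bdd_belowI[of _ t] simp: not_less)

lemma le_backward_jump: "s \<in> T \<Longrightarrow> s < t \<Longrightarrow> s \<le> backward_jump T t"
  unfolding backward_jump_def by (auto intro!: cSup_upper bdd_aboveI[of _ t])

text \<open>An intermediate value argument: let \<open>a\<close> be the last point with
  \<open>g a \<ge> c\<close> and \<open>b\<close> the first point from \<open>a\<close> on with
  \<open>g b \<le> c\<close>. No point of \<open>T\<close> lies between them, so \<open>a\<close> is
  the backward jump of \<open>b\<close>.\<close>

lemma left_scattered_sign_change:
  fixes g :: "real \<Rightarrow> real"
  assumes "closed T" "continuous_on (T \<inter> {p..q}) g" "p \<in> T" "q \<in> T" "p < q" "g p > c" "g q < c"
    and ne: "\<And>s. s \<in> T \<inter> {p..q} \<Longrightarrow> g s \<noteq> c"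
  shows "\<exists>b\<in>T \<inter> {p..q}. left_scattered T b \<and> g (backward_jump T b) > c \<and> g b < c"
proof -
  let ?K = "T \<inter> {p..q}"
  have K: "closed ?K" using assms(1) by (simp add: closed_Int)
  have comp: "compact (S \<inter> {p..q})" if "closed S" for S
    using that by (simp add: closed_Int_compact)
  let ?A = "{s \<in> ?K. c \<le> g s} \<inter> {p..q}"
  have "compact ?A"
    by (intro comp continuous_on_closed_Collect_le K assms(2) continuous_on_const)
  moreover have "p \<in> ?A" using assms by auto
  ultimately obtain a where a: "a \<in> ?A" "\<And>x. x \<in> ?A \<Longrightarrow> x \<le> a"
    using compact_attains_sup[of ?A] by blast
  let ?B = "{s \<in> ?K. g s \<le> c} \<inter> {p..q} \<inter> {a..q}"
  have "compact ?B"
    by (intro compact_Int_closed[OF comp] continuous_on_closed_Collect_le K assms(2)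
        continuous_on_const closed_atLeastAtMost)
  moreover have "q \<in> ?B" using assms a by auto
  ultimately obtain b where b: "b \<in> ?B" "\<And>x. x \<in> ?B \<Longrightarrow> b \<le> x"
    using compact_attains_inf[of ?B] by blast
  have sign: "g a > c" "g b < c"
    using a(1) b(1) ne[of a] ne[of b] by auto
  then have "a < b" using b(1) by (cases "a = b") auto
  moreover have "b \<le> x" if "x \<in> T" "a < x" for x
  proof (rule ccontr)
    assume "\<not> b \<le> x"
    \<comment> \<open>Such an \<open>x\<close> is beyond the maximum of \<open>?A\<close> and before
      the minimum of \<open>?B\<close>, but comparing \<open>g x\<close> with \<open>c\<close> puts
      it into one of them.\<close>
    then have "x \<notin> ?A" "x \<notin> ?B" using a(2)[of x] b(2)[of x] that by (meson leD, blast)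
    moreover have "x \<in> {p..q} \<inter> {a..q}" using \<open>\<not> b \<le> x\<close> a(1) b(1) that by auto
    ultimately show False using that(1) by auto
  qed
  ultimately have "backward_jump T b = a"
    using a(1) by (intro backward_jump_gap) auto
  then show ?thesis
    using b(1) sign \<open>a < b\<close> by (intro bexI[of _ b]) (auto simp: left_scattered_def)
qed

lemma constant_sign:
  fixes g :: "real \<Rightarrow> real"
  assumes "closed T" "is_interval J" "continuous_on (T \<inter> J) g"
    and ne: "\<And>s. s \<in> T \<inter> J \<Longrightarrow> g s \<noteq> c"
    and gap: "\<And>s. s \<in> T \<inter> J \<Longrightarrow> left_scattered T s \<Longrightarrow>
           g s \<le> c \<and> g (backward_jump T s) \<le> c \<or> g s \<ge> c \<and> g (backward_jump T s) \<ge> c"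
  shows "(\<forall>s\<in>T \<inter> J. g s > c) \<or> (\<forall>s\<in>T \<inter> J. g s < c)"
proof (rule ccontr)
  \<comment> \<open>Treating \<open>g\<close> with \<open>c\<close> and \<open>- g\<close> with
    \<open>- c\<close> together covers both directions of a sign change.\<close>
  have change: False
    if p: "p \<in> T \<inter> J" "h p > k" and q: "q \<in> T \<inter> J" "h q < k" and "p < q"
      and h: "h = g \<and> k = c \<or> h = (\<lambda>x. - g x) \<and> k = - c" for p q k h
  proof -
    have sub: "T \<inter> {p..q} \<subseteq> T \<inter> J"
      using assms(2) p(1) q(1) unfolding is_interval_1 by auto
    have "continuous_on (T \<inter> J) h"
      using h assms(3) by (auto intro: continuous_on_minus)
    then have "continuous_on (T \<inter> {p..q}) h"
      using sub by (rule continuous_on_subset)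
    moreover have "h s \<noteq> k" if "s \<in> T \<inter> {p..q}" for s
      using ne[of s] h sub that by auto
    ultimately have "\<exists>b\<in>T \<inter> {p..q}. left_scattered T b \<and> h (backward_jump T b) > k \<and> h b < k"
      using p q \<open>p < q\<close> by (intro left_scattered_sign_change[OF assms(1)]) auto
    then obtain b where b: "b \<in> T \<inter> {p..q}" "left_scattered T b" "h (backward_jump T b) > k" "h b < k"
      by blast
    then have "b \<in> T \<inter> J" using sub by blast
    from gap[OF this b(2)] show False using b(3,4) h by auto
  qed
  assume "\<not> ?thesis"
  then obtain p q where "p \<in> T \<inter> J" "\<not> g p < c" "q \<in> T \<inter> J" "\<not> g q > c"
    by blast
  then have pq: "p \<in> T \<inter> J" "g p > c" "q \<in> T \<inter> J" "g q < c"
    using ne[of p] ne[of q] by auto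
  show False
  proof (cases p q rule: linorder_cases)
    case less
    then show False using change[where h = g, OF pq(1,2) pq(3,4)] by simp
  next
    case greater
    then show False using change[where p = q and q = p and h = "\<lambda>x. - g x" and k = "- c"] pq by simp
  qed (use pq in auto)
qed

section \<open>Continuity and width of the endpoint functions\<close>

text \<open>At a fixed level each endpoint is a 1-Lipschitz function for the supremum
  metric.\<close>

lemma continuous_on_endpoints:
  fixes f :: "'a::topological_space \<Rightarrow> fuzzy"
  assumes "continuous_on S f" "\<alpha> \<in> {0..1}"
  shows "continuous_on S (\<lambda>s. lower (f s) \<alpha>)" "continuous_on S (\<lambda>s. upper (f s) \<alpha>)"
proof -
  have "1-lipschitz_on UNIV (\<lambda>u. lower u \<alpha>)" "1-lipschitz_on UNIV (\<lambda>u. upper u \<alpha>)"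
    using endpoint_dist_le[OF assms(2)] by (auto simp: lipschitz_on_def dist_real_def)
  then show "continuous_on S (\<lambda>s. lower (f s) \<alpha>)" "continuous_on S (\<lambda>s. upper (f s) \<alpha>)"
    by (auto intro: continuous_on_compose2[OF lipschitz_on_continuous_on assms(1)])
qed

text \<open>Adding \<open>w\<close> adds its nonnegative width. Through this inequality the assumed
  Hukuhara differences control the sign of a change of width.\<close>

lemma H_diff_exists_width_le:
  assumes "H_diff_exists u v" "\<alpha> \<in> {0..1}"
  shows "upper v \<alpha> - lower v \<alpha> \<le> upper u \<alpha> - lower u \<alpha>"
proof -
  obtain w where "u = v + w" using assms(1) by (auto simp: H_diff_exists_def)
  then show ?thesis using lower_upper_plus[OF assms(2), of v w] level_eq(2)[OF assms(2), of w] by simp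
qed

text \<open>For \<open>\<epsilon>\<close> small compared with the width of the support of the derivative, the sign below tells
  whether the endpoint slopes at \<open>s\<close> approximate those of the derivative or the swapped ones.\<close>

lemma endpoints_near_width:
  assumes "backward_jump T t = t" "endpoints_near T f l u t \<epsilon> s" "s \<noteq> t" "2 * \<epsilon> < \<bar>u 0 - l 0\<bar>"
  shows "((upper (f s) 0 - lower (f s) 0) - (upper (f t) 0 - lower (f t) 0)) * ((u 0 - l 0) * (s - t)) > 0"
proof -
  define x where "x = (u 0 - l 0) * (s - t)"
  define y where "y = (upper (f s) 0 - lower (f s) 0) - (upper (f t) 0 - lower (f t) 0)"
  have "\<bar>lower (f t) 0 - lower (f s) 0 - l 0 * (t - s)\<bar> \<le> \<epsilon> * \<bar>t - s\<bar>"
    "\<bar>upper (f t) 0 - upper (f s) 0 - u 0 * (t - s)\<bar> \<le> \<epsilon> * \<bar>t - s\<bar>"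
    using assms(1,2) by (auto simp: endpoints_near_def nabla_near_def nabla_bound_on_def)
  moreover have "y - x = (lower (f t) 0 - lower (f s) 0 - l 0 * (t - s)) -
      (upper (f t) 0 - upper (f s) 0 - u 0 * (t - s))"
    by (simp add: x_def y_def algebra_simps)
  ultimately have "\<bar>y - x\<bar> \<le> 2 * \<epsilon> * \<bar>t - s\<bar>"
    by linarith
  also have "\<dots> < \<bar>u 0 - l 0\<bar> * \<bar>t - s\<bar>"
    using assms(3,4) by (intro mult_strict_right_mono) auto
  also have "\<dots> = \<bar>x\<bar>" by (simp add: x_def abs_mult abs_minus_commute)
  \<comment> \<open>\<open>y\<close> is closer to \<open>x\<close> than 0 is, so both have the same
    sign.\<close>
  finally have "y * x > 0"
    by (cases "x > 0") (auto simp: zero_less_mult_iff)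
  then show ?thesis by (simp add: x_def y_def)
qed

section \<open>Endpoint estimates from the generalized derivative\<close>

text \<open>Use \<open>h = t - s\<close> for \<open>s < t\<close> and \<open>h = s - t\<close>
  otherwise. In both cases the factor of \<open>F\<close> is nonnegative, as
  \<open>gH_diff_near_scaleR\<close> requires: points of \<open>T\<close> below \<open>t\<close> do
  not exceed its backward jump.\<close>

lemma has_nabla_gH_derivative_endpoints:
  assumes gH: "has_nabla_gH_derivative T f F t" and t: "t \<in> T" and "\<epsilon> > 0"
  shows "\<forall>\<^sub>F s in at t within T.
    endpoints_near T f (lower F) (upper F) t \<epsilon> s \<or> endpoints_near T f (upper F) (lower F) t \<epsilon> s"
proof -
  let ?\<rho> = "backward_jump T t"
  obtain \<eta> where "\<eta> > 0" and \<eta>: "\<And>h. 0 \<le> h \<Longrightarrow> h < \<eta> \<Longrightarrow>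
      (t + h \<in> T \<longrightarrow> gH_diff_exists (f (t + h)) (f ?\<rho>) \<and>
         dist (f (t + h) \<ominus>\<^sub>g\<^sub>H f ?\<rho>) ((h + graininess T t) *\<^sub>R F) \<le> \<epsilon> * \<bar>h + graininess T t\<bar>) \<and>
      (t - h \<in> T \<longrightarrow> gH_diff_exists (f ?\<rho>) (f (t - h)) \<and>
         dist (f ?\<rho> \<ominus>\<^sub>g\<^sub>H f (t - h)) ((h - graininess T t) *\<^sub>R F) \<le> \<epsilon> * \<bar>h - graininess T t\<bar>)"
    using gH \<open>\<epsilon> > 0\<close> unfolding has_nabla_gH_derivative_def by metis
  have "endpoints_near T f (lower F) (upper F) t \<epsilon> s \<or> endpoints_near T f (upper F) (lower F) t \<epsilon> s"
    if s: "s \<in> T" "\<bar>s - t\<bar> < \<eta>" for s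
  proof (cases "s < t")
    case True
    have "gH_diff_exists (f ?\<rho>) (f s)" "dist (f ?\<rho> \<ominus>\<^sub>g\<^sub>H f s) ((?\<rho> - s) *\<^sub>R F) \<le> \<epsilon> * \<bar>?\<rho> - s\<bar>"
      using \<eta>[of "t - s"] s True by (simp_all add: graininess_def)
    from gH_diff_near_scaleR[OF this] le_backward_jump[OF s(1) True] show ?thesis
      by (simp add: endpoints_near_def nabla_near_def nabla_bound_on_def mult.commute ball_conj_distrib)
  next
    case False
    have "gH_diff_exists (f s) (f ?\<rho>)" "dist (f s \<ominus>\<^sub>g\<^sub>H f ?\<rho>) ((s - ?\<rho>) *\<^sub>R F) \<le> \<epsilon> * \<bar>s - ?\<rho>\<bar>"
      using \<eta>[of "s - t"] s False by (simp_all add: graininess_def)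
    from gH_diff_near_scaleR[OF this] backward_jump_le[OF t] False
    have *: "(\<forall>\<alpha>\<in>{0..1}.
          \<bar>lower (f s) \<alpha> - lower (f ?\<rho>) \<alpha> - (s - ?\<rho>) * lower F \<alpha>\<bar> \<le> \<epsilon> * \<bar>s - ?\<rho>\<bar> \<and>
          \<bar>upper (f s) \<alpha> - upper (f ?\<rho>) \<alpha> - (s - ?\<rho>) * upper F \<alpha>\<bar> \<le> \<epsilon> * \<bar>s - ?\<rho>\<bar>) \<or>
        (\<forall>\<alpha>\<in>{0..1}.
          \<bar>lower (f s) \<alpha> - lower (f ?\<rho>) \<alpha> - (s - ?\<rho>) * upper F \<alpha>\<bar> \<le> \<epsilon> * \<bar>s - ?\<rho>\<bar> \<and>
          \<bar>upper (f s) \<alpha> - upper (f ?\<rho>) \<alpha> - (s - ?\<rho>) * lower F \<alpha>\<bar> \<le> \<epsilon> * \<bar>s - ?\<rho>\<bar>)"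
      by simp
    have flip: "\<bar>x - y - (s - ?\<rho>) * d\<bar> = \<bar>y - x - d * (?\<rho> - s)\<bar>" for x y d
      by (simp add: abs_if algebra_simps)
    show ?thesis
      using * unfolding flip
      by (simp add: endpoints_near_def nabla_near_def nabla_bound_on_def abs_minus_commute ball_conj_distrib)
  qed
  then show ?thesis
    using \<open>\<eta> > 0\<close> by (auto simp: eventually_at dist_real_def)
qed

text \<open>With increment 0 the points compared do not depend on the tolerance, so letting it tend
  to 0 makes the estimate exact.\<close>

lemma has_nabla_gH_derivative_endpoints_at:
  assumes gH: "has_nabla_gH_derivative T f F t" and t: "t \<in> T"
  shows "endpoints_near T f (lower F) (upper F) t 0 t \<or> endpoints_near T f (upper F) (lower F) t 0 t"
proof -
  let ?\<rho> = "backward_jump T t" and ?\<nu> = "graininess T t"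
  have \<nu>: "?\<nu> \<ge> 0" using backward_jump_le[OF t] by (simp add: graininess_def)
  have ex: "gH_diff_exists (f t) (f ?\<rho>)"
    and le: "dist (f t \<ominus>\<^sub>g\<^sub>H f ?\<rho>) (?\<nu> *\<^sub>R F) \<le> \<epsilon> * \<bar>?\<nu>\<bar>" if "\<epsilon> > 0" for \<epsilon>
    using gH[unfolded has_nabla_gH_derivative_def, rule_format, OF that] t by force+
  have "dist (f t \<ominus>\<^sub>g\<^sub>H f ?\<rho>) (?\<nu> *\<^sub>R F) \<le> 0 + e" if "e > 0" for e
  proof -
    \<comment> \<open>The added 1 keeps the divisor positive when the graininess is 0.\<close>
    have "e / (?\<nu> + 1) * \<bar>?\<nu>\<bar> \<le> e"
      using \<nu> that by (simp add: field_simps)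
    then show ?thesis using le[of "e / (?\<nu> + 1)"] \<nu> that by simp
  qed
  then have "dist (f t \<ominus>\<^sub>g\<^sub>H f ?\<rho>) (?\<nu> *\<^sub>R F) \<le> 0" by (rule field_le_epsilon)
  from gH_diff_near_scaleR[OF ex[OF zero_less_one] this \<nu>] show ?thesis
    by (auto simp: endpoints_near_def nabla_near_def nabla_bound_on_def graininess_def algebra_simps)
qed

section \<open>Left-scattered points\<close>

text \<open>Passing from \<open>t\<close> to \<open>s\<close> changes the exact relation at
  \<open>t\<close> only by the increment of \<open>\<phi> \<alpha>\<close> and by
  \<open>d \<alpha> * (s - t)\<close>. Both are uniformly small, while the distance of
  \<open>s\<close> from the backward jump of \<open>t\<close> stays bounded away from 0.\<close>

lemma nabla_near_left_scattered:
  assumes "t \<in> T" "left_scattered T t" "nabla_near T \<phi> d t 0 t" "\<epsilon> > 0"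
    and equicont: "\<And>e. e > 0 \<Longrightarrow> \<forall>\<^sub>F s in at t within T. \<forall>\<alpha>\<in>{0..1}. \<bar>\<phi> \<alpha> s - \<phi> \<alpha> t\<bar> < e"
    and bound: "\<And>\<alpha>. \<alpha> \<in> {0..1} \<Longrightarrow> \<bar>d \<alpha>\<bar> \<le> M"
  shows "\<forall>\<^sub>F s in at t within T. nabla_near T \<phi> d t \<epsilon> s"
proof -
  let ?\<rho> = "backward_jump T t"
  define \<nu> where "\<nu> = t - ?\<rho>"
  have \<nu>: "\<nu> > 0" using assms(2) by (simp add: \<nu>_def left_scattered_def)
  have M: "M \<ge> 0" using bound[of 0] by simp
  \<comment> \<open>The first bound keeps \<open>s\<close> at distance at least
    \<open>\<nu> / 2\<close> from the backward jump; the second makes the error from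
    \<open>d \<alpha>\<close> at most \<open>\<epsilon> * \<nu> / 4\<close>, half of what is
    allowed.\<close>
  define r where "r = min (\<nu> / 2) (\<epsilon> * \<nu> / (4 * (M + 1)))"
  have "r > 0" using \<nu> M assms(4) by (simp add: r_def)
  then have "\<forall>\<^sub>F s in at t within T. dist s t < r"
    unfolding eventually_at by auto
  moreover have "\<forall>\<^sub>F s in at t within T. \<forall>\<alpha>\<in>{0..1}. \<bar>\<phi> \<alpha> s - \<phi> \<alpha> t\<bar> < \<epsilon> * \<nu> / 4"
    using equicont[of "\<epsilon> * \<nu> / 4"] \<nu> assms(4) by simp
  ultimately show ?thesis
  proof eventually_elim
    case (elim s)
    then have s: "\<bar>s - t\<bar> < r" by (simp add: dist_real_def)
    have "\<bar>\<phi> \<alpha> ?\<rho> - \<phi> \<alpha> s - d \<alpha> * (?\<rho> - s)\<bar> \<le> \<epsilon> * \<bar>?\<rho> - s\<bar>" if \<alpha>: "\<alpha> \<in> {0..1}" for \<alpha>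
    proof -
      have "\<bar>d \<alpha> * (s - t)\<bar> \<le> (M + 1) * r"
        unfolding abs_mult using bound[OF \<alpha>] s M by (intro mult_mono) auto
      also have "\<dots> \<le> \<epsilon> * \<nu> / 4"
      proof -
        have "(M + 1) * r \<le> (M + 1) * (\<epsilon> * \<nu> / (4 * (M + 1)))"
          using M by (intro mult_left_mono) (auto simp: r_def)
        also have "\<dots> = \<epsilon> * \<nu> / 4"
          using M nonzero_mult_divide_mult_cancel_left[of "M + 1" "\<epsilon> * \<nu>" 4] by (simp add: mult.commute)
        finally show ?thesis .
      qed
      finally have 1: "\<bar>d \<alpha> * (s - t)\<bar> \<le> \<epsilon> * \<nu> / 4" .
      have 2: "\<phi> \<alpha> ?\<rho> - \<phi> \<alpha> t - d \<alpha> * (?\<rho> - t) = 0"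
        using assms(3) \<alpha> by (simp add: nabla_near_def nabla_bound_on_def)
      have "\<phi> \<alpha> ?\<rho> - \<phi> \<alpha> s - d \<alpha> * (?\<rho> - s) =
          (\<phi> \<alpha> ?\<rho> - \<phi> \<alpha> t - d \<alpha> * (?\<rho> - t)) - (\<phi> \<alpha> s - \<phi> \<alpha> t) + d \<alpha> * (s - t)"
        by (simp add: algebra_simps)
      then have "\<bar>\<phi> \<alpha> ?\<rho> - \<phi> \<alpha> s - d \<alpha> * (?\<rho> - s)\<bar> \<le> \<epsilon> * \<nu> / 4 + \<epsilon> * \<nu> / 4"
        using 1 2 bspec[OF elim(2) \<alpha>] by linarith
      also have "\<dots> = \<epsilon> * (\<nu> / 2)" by simp
      also have "\<dots> \<le> \<epsilon> * \<bar>?\<rho> - s\<bar>"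
      proof (rule mult_left_mono)
        have "\<bar>s - t\<bar> < \<nu> / 2" using s by (simp add: r_def)
        then show "\<nu> / 2 \<le> \<bar>?\<rho> - s\<bar>" unfolding \<nu>_def
          by (simp add: abs_if split: if_splits)
      qed (use assms(4) in simp)
      finally show ?thesis .
    qed
    then show ?case by (simp add: nabla_near_def nabla_bound_on_def)
  qed
qed

text \<open>Continuity in the supremum metric is equicontinuity of the endpoint functions over all
  levels.\<close>

lemma endpoints_near_left_scattered:
  assumes "t \<in> T" "left_scattered T t" "endpoints_near T f l u t 0 t" "\<epsilon> > 0"
    and "(f \<longlongrightarrow> f t) (at t within T)"
    and "\<And>\<alpha>. \<alpha> \<in> {0..1} \<Longrightarrow> \<bar>l \<alpha>\<bar> \<le> M \<and> \<bar>u \<alpha>\<bar> \<le> M"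
  shows "\<forall>\<^sub>F s in at t within T. endpoints_near T f l u t \<epsilon> s"
  unfolding endpoints_near_def
proof (rule eventually_conj)
  have "\<forall>\<^sub>F s in at t within T. \<forall>\<alpha>\<in>{0..1}.
      \<bar>lower (f s) \<alpha> - lower (f t) \<alpha>\<bar> < e \<and> \<bar>upper (f s) \<alpha> - upper (f t) \<alpha>\<bar> < e" if "e > 0" for e
    using tendstoD[OF assms(5) that]
    by eventually_elim (use endpoint_dist_le in \<open>blast intro: le_less_trans\<close>)
  note ev = this[unfolded ball_conj_distrib eventually_conj_iff]
  show "\<forall>\<^sub>F s in at t within T. nabla_near T (\<lambda>\<alpha> s. lower (f s) \<alpha>) l t \<epsilon> s"
    using assms ev by (intro nabla_near_left_scattered[where M = M]) (auto simp: endpoints_near_def)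
  show "\<forall>\<^sub>F s in at t within T. nabla_near T (\<lambda>\<alpha> s. upper (f s) \<alpha>) u t \<epsilon> s"
    using assms ev by (intro nabla_near_left_scattered[where M = M]) (auto simp: endpoints_near_def)
qed

section \<open>A constant choice on each side when the backward jump is \<open>t\<close>\<close>

text \<open>In \<open>alt\<close> the choice may depend on \<open>s\<close> and
  \<open>\<epsilon>\<close>. If the support of \<open>F\<close> has positive width, the sign of
  \<open>(g s - g t) * (s - t)\<close> determines it, and this sign is constant on one side near
  \<open>t\<close>.\<close>

lemma endpoints_near_one_sided:
  assumes "closed T" "backward_jump T t = t" "\<delta> > 0"
    and A: "A = {t<..} \<or> A = {..<t}"
    and cont: "continuous_on ({t - \<delta><..<t + \<delta>} \<inter> T) f"
    and H: "\<And>s. s \<in> {t - \<delta><..<t + \<delta>} \<inter> T \<Longrightarrow> left_scattered T s \<Longrightarrow>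
           (H_diff_exists (f t) (f s) \<and> H_diff_exists (f t) (f (backward_jump T s))) \<or>
           (H_diff_exists (f s) (f t) \<and> H_diff_exists (f (backward_jump T s)) (f t))"
    and alt: "\<And>\<epsilon>. \<epsilon> > 0 \<Longrightarrow> \<forall>\<^sub>F s in at t within T.
      endpoints_near T f (lower F) (upper F) t \<epsilon> s \<or> endpoints_near T f (upper F) (lower F) t \<epsilon> s"
  shows "(\<forall>\<epsilon>>0. \<forall>\<^sub>F s in at t within T \<inter> A. endpoints_near T f (lower F) (upper F) t \<epsilon> s) \<or>
         (\<forall>\<epsilon>>0. \<forall>\<^sub>F s in at t within T \<inter> A. endpoints_near T f (upper F) (lower F) t \<epsilon> s)"
proof -
  let ?E = "endpoints_near T f (lower F) (upper F) t"
  let ?E' = "endpoints_near T f (upper F) (lower F) t"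
  have altA: "\<forall>\<^sub>F s in at t within T \<inter> A. ?E \<epsilon> s \<or> ?E' \<epsilon> s" if "\<epsilon> > 0" for \<epsilon>
    using alt[OF that] by (rule filter_leD[OF at_le, rotated]) simp
  define L where "L = upper F 0 - lower F 0"
  show ?thesis
  proof (cases "L = 0")
    case True
    \<comment> \<open>The support contains every level set, so width 0 there makes the two choices
      coincide.\<close>
    have "upper F \<alpha> = lower F \<alpha>" if "\<alpha> \<in> {0..1}" for \<alpha>
      using True endpoints_in_support[OF that, of F] level_eq(2)[OF that, of F] by (simp add: L_def)
    then have "?E' \<epsilon> s = ?E \<epsilon> s" for \<epsilon> s
      by (simp add: endpoints_near_def nabla_near_def)
    then show ?thesis using altA by simp
  next
    case False
    then have L: "L > 0" using level_eq(2)[of 0 F] by (simp add: L_def)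
    define g where "g s = upper (f s) 0 - lower (f s) 0" for s
    \<comment> \<open>The bound \<open>L / 4\<close> gives \<open>2 * \<epsilon> < L\<close>, the
      accuracy at which the width detects the choice.\<close>
    have pos: "(g s - g t) * (s - t) > 0" if "?E \<epsilon> s" "\<epsilon> \<le> L / 4" "s \<noteq> t" for s \<epsilon>
    proof -
      have "L * ((g s - g t) * (s - t)) > 0"
        using endpoints_near_width[OF assms(2) that(1,3)] that(2) L unfolding g_def L_def
        by (simp add: algebra_simps)
      then show ?thesis using L by (simp add: zero_less_mult_iff)
    qed
    have neg: "(g s - g t) * (s - t) < 0" if "?E' \<epsilon> s" "\<epsilon> \<le> L / 4" "s \<noteq> t" for s \<epsilon>
    proof -
      have "L * ((g s - g t) * (s - t)) < 0"
        using endpoints_near_width[OF assms(2) that(1,3)] that(2) L unfolding g_def L_def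
        by (simp add: algebra_simps)
      then show ?thesis using L by (simp add: zero_less_mult_iff mult_less_0_iff)
    qed
    obtain \<eta>0 where "\<eta>0 > 0"
      and \<eta>0: "\<And>s. s \<in> T \<Longrightarrow> s \<noteq> t \<Longrightarrow> \<bar>s - t\<bar> < \<eta>0 \<Longrightarrow> ?E (L / 4) s \<or> ?E' (L / 4) s"
      using alt[of "L / 4"] L unfolding eventually_at dist_real_def by auto
    define \<eta> where "\<eta> = min \<eta>0 \<delta>"
    have "\<eta> > 0" using \<open>\<eta>0 > 0\<close> assms(3) by (simp add: \<eta>_def)
    define J where "J = A \<inter> {t - \<eta><..<t + \<eta>}"
    have tJ: "t \<notin> J" using A by (auto simp: J_def)
    have J: "T \<inter> J \<subseteq> {t - \<delta><..<t + \<delta>} \<inter> T" by (auto simp: J_def \<eta>_def)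
    have sign: "(\<forall>s\<in>T \<inter> J. g s > g t) \<or> (\<forall>s\<in>T \<inter> J. g s < g t)"
    proof (rule constant_sign[OF assms(1)])
      show "is_interval J"
        using A unfolding J_def by (auto intro!: is_interval_Int is_interval_io is_interval_oi is_interval_oo)
      show "continuous_on (T \<inter> J) g"
        unfolding g_def using continuous_on_subset[OF cont J]
        by (intro continuous_on_diff continuous_on_endpoints) auto
    next
      fix s assume s: "s \<in> T \<inter> J"
      then have "s \<noteq> t" "\<bar>s - t\<bar> < \<eta>0" using tJ by (auto simp: J_def \<eta>_def)
      then show "g s \<noteq> g t" using \<eta>0[of s] s pos[of "L / 4" s] neg[of "L / 4" s] by auto
      assume ls: "left_scattered T s"
      have le: "g y \<le> g x" if "H_diff_exists (f x) (f y)" for x y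
        using H_diff_exists_width_le[OF that, of 0] by (simp add: g_def)
      \<comment> \<open>Both Hukuhara differences point in the same direction, so the widths at
        \<open>s\<close> and at its backward jump lie on the same side of \<open>g t\<close>. The
        inequalities are weak; the backward jump may be \<open>t\<close> itself.\<close>
      show "g s \<le> g t \<and> g (backward_jump T s) \<le> g t \<or> g s \<ge> g t \<and> g (backward_jump T s) \<ge> g t"
        using H[OF subsetD[OF J s] ls] le by blast
    qed
    have evJ: "\<forall>\<^sub>F s in at t within T \<inter> A. s \<in> T \<inter> J"
      unfolding eventually_at J_def using \<open>\<eta> > 0\<close> by (intro exI[of _ \<eta>]) (auto simp: dist_real_def)
    have ev: "\<forall>\<^sub>F s in at t within T \<inter> A. (?E \<epsilon> s \<or> ?E' \<epsilon> s) \<and>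
        (?E \<epsilon> s \<or> (g s - g t) * (s - t) < 0) \<and> (?E' \<epsilon> s \<or> (g s - g t) * (s - t) > 0) \<and> s \<in> T \<inter> J"
      if "\<epsilon> > 0" for \<epsilon>
    proof -
      \<comment> \<open>The sign test needs accuracy \<open>L / 4\<close>; the estimate obtained
        with \<open>r\<close> is weakened to \<open>\<epsilon>\<close> afterwards.\<close>
      define r where "r = min \<epsilon> (L / 4)"
      have r: "0 < r" "r \<le> \<epsilon>" "r \<le> L / 4"
        using L that by (auto simp: r_def)
      from altA[OF r(1)] evJ show ?thesis
      proof eventually_elim
        case (elim s)
        have "s \<noteq> t" using elim(2) tJ by auto
        then show ?case
          using elim pos[OF _ r(3)] neg[OF _ r(3)] endpoints_near_mono[OF _ r(2)] by blast
      qed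
    qed
    \<comment> \<open>The factor \<open>s - t\<close> has one sign on \<open>A\<close>, so the
      constant sign of \<open>g s - g t\<close> passes to the product.\<close>
    consider "\<forall>s\<in>T \<inter> J. (g s - g t) * (s - t) > 0" | "\<forall>s\<in>T \<inter> J. (g s - g t) * (s - t) < 0"
      using A sign unfolding J_def by (auto simp: zero_less_mult_iff mult_less_0_iff)
    then show ?thesis
    proof cases
      case 1
      have "\<forall>\<^sub>F s in at t within T \<inter> A. ?E \<epsilon> s" if "\<epsilon> > 0" for \<epsilon>
        using ev[OF that] by eventually_elim (use 1 in force)
      then show ?thesis by blast
    next
      case 2
      have "\<forall>\<^sub>F s in at t within T \<inter> A. ?E' \<epsilon> s" if "\<epsilon> > 0" for \<epsilon>
        using ev[OF that] by eventually_elim (use 2 in force)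
      then show ?thesis by blast
    qed
  qed
qed

section \<open>Assembly of the two cases\<close>

theorem theorem12:
  fixes T :: "real set" and f :: "real \<Rightarrow> fuzzy" and F :: fuzzy and t \<delta> :: real
  assumes "time_scale T"
    and "t \<in> T_kappa T"
    and "has_nabla_gH_derivative T f F t"
    and "\<delta> > 0"
    and "continuous_on ({t - \<delta><..<t + \<delta>} \<inter> T) f"
    and "\<And>s. s \<in> {t - \<delta><..<t + \<delta>} \<inter> T \<Longrightarrow> left_scattered T s \<Longrightarrow>
           (H_diff_exists (f t) (f s) \<and> H_diff_exists (f t) (f (backward_jump T s))) \<or>
           (H_diff_exists (f s) (f t) \<and> H_diff_exists (f (backward_jump T s)) (f t))"
  shows
    "(\<exists>dl du.
        has_nabla_derivative_uniformly T (\<lambda>\<alpha> s. lower (f s) \<alpha>) dl t \<and>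
        has_nabla_derivative_uniformly T (\<lambda>\<alpha> s. upper (f s) \<alpha>) du t \<and>
        ((\<forall>\<alpha>\<in>{0..1}. level F \<alpha> = {dl \<alpha>..du \<alpha>}) \<or>
         (\<forall>\<alpha>\<in>{0..1}. level F \<alpha> = {du \<alpha>..dl \<alpha>})))
     \<or>
     (\<exists>dl_left dl_right du_left du_right.
        has_left_nabla_uniformly T (\<lambda>\<alpha> s. lower (f s) \<alpha>) dl_left t \<and>
        has_right_nabla_uniformly T (\<lambda>\<alpha> s. lower (f s) \<alpha>) dl_right t \<and>
        has_left_nabla_uniformly T (\<lambda>\<alpha> s. upper (f s) \<alpha>) du_left t \<and>
        has_right_nabla_uniformly T (\<lambda>\<alpha> s. upper (f s) \<alpha>) du_right t \<and>
        (\<forall>\<alpha>\<in>{0..1}. dl_left \<alpha> = du_right \<alpha> \<and> dl_right \<alpha> = du_left \<alpha>) \<and>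
        ((\<forall>\<alpha>\<in>{0..1}. level F \<alpha> = {dl_right \<alpha>..du_right \<alpha>} \<and>
                      level F \<alpha> = {du_left \<alpha>..dl_left \<alpha>}) \<or>
         (\<forall>\<alpha>\<in>{0..1}. level F \<alpha> = {dl_left \<alpha>..du_left \<alpha>} \<and>
                      level F \<alpha> = {du_right \<alpha>..dl_right \<alpha>})))"
proof -
  let ?lo = "\<lambda>\<alpha> s. lower (f s) \<alpha>" and ?up = "\<lambda>\<alpha> s. upper (f s) \<alpha>"
  have T: "closed T" and t: "t \<in> T"
    using assms(1,2) by (auto simp: time_scale_def T_kappa_def)
  have lev: "level F \<alpha> = {lower F \<alpha>..upper F \<alpha>}" if "\<alpha> \<in> {0..1}" for \<alpha>
    by (rule level_eq(1)[OF that])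
  have case_i: ?thesis
    if lu: "l = lower F \<and> u = upper F \<or> l = upper F \<and> u = lower F"
      and at: "\<And>\<epsilon>. \<epsilon> > 0 \<Longrightarrow> endpoints_near T f l u t \<epsilon> t"
      and near: "\<And>\<epsilon>. \<epsilon> > 0 \<Longrightarrow> \<forall>\<^sub>F s in at t within T. endpoints_near T f l u t \<epsilon> s" for l u
  proof -
    have "has_nabla_derivative_uniformly T ?lo l t" "has_nabla_derivative_uniformly T ?up u t"
      using at near by (auto intro!: has_nabla_derivative_uniformlyI[OF t]
          simp: endpoints_near_def eventually_conj_iff)
    moreover have "(\<forall>\<alpha>\<in>{0..1}. level F \<alpha> = {l \<alpha>..u \<alpha>}) \<or> (\<forall>\<alpha>\<in>{0..1}. level F \<alpha> = {u \<alpha>..l \<alpha>})"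
      using lu lev by blast
    ultimately show ?thesis by blast
  qed
  show ?thesis
  proof (cases "left_scattered T t")
    case True
    have "(f \<longlongrightarrow> f t) (at t within {t - \<delta><..<t + \<delta>} \<inter> T)"
      using assms(4,5) t by (auto simp: continuous_on_def)
    then have lim: "(f \<longlongrightarrow> f t) (at t within T)"
      using at_within_nhd[of t "{t - \<delta><..<t + \<delta>}" "{t - \<delta><..<t + \<delta>} \<inter> T" T] assms(4)
      by (auto simp: Int_ac)
    obtain l u where lu: "l = lower F \<and> u = upper F \<or> l = upper F \<and> u = lower F"
      and at: "endpoints_near T f l u t 0 t"
      using has_nabla_gH_derivative_endpoints_at[OF assms(3) t] by blast
    \<comment> \<open>All endpoints of \<open>F\<close> lie between those of its support, so this
      bound serves every level.\<close>
    have bound: "\<bar>l \<alpha>\<bar> \<le> \<bar>lower F 0\<bar> + \<bar>upper F 0\<bar> \<and> \<bar>u \<alpha>\<bar> \<le> \<bar>lower F 0\<bar> + \<bar>upper F 0\<bar>"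
      if "\<alpha> \<in> {0..1}" for \<alpha>
      using lu endpoints_in_support[OF that, of F] level_eq(2)[OF that, of F] by auto
    show ?thesis
      using endpoints_near_mono[OF at] endpoints_near_left_scattered[OF t True at _ lim bound]
      by (intro case_i[OF lu]) auto
  next
    case False
    then have \<rho>: "backward_jump T t = t"
      using backward_jump_le[OF t] by (simp add: left_scattered_def)
    note alt = has_nabla_gH_derivative_endpoints[OF assms(3) t]
    define N where "N A l u \<longleftrightarrow> (\<forall>\<epsilon>>0. \<forall>\<^sub>F s in at t within T \<inter> A. endpoints_near T f l u t \<epsilon> s)" for A l u
    have sides: "N A (lower F) (upper F) \<or> N A (upper F) (lower F)" if "A = {t<..} \<or> A = {..<t}" for A
      unfolding N_def using endpoints_near_one_sided[OF T \<rho> assms(4) that assms(5,6) alt] by blast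
    \<comment> \<open>On a side where \<open>t\<close> is not a limit point the filter is trivial,
      so that side agrees with any choice.\<close>
    have isolated: "N A l u" if "\<not> t islimpt T \<inter> A" for A l u
      using that by (simp add: N_def trivial_limit_within[symmetric] trivial_limit_eventually)
    have same: ?thesis
      if lu: "l = lower F \<and> u = upper F \<or> l = upper F \<and> u = lower F"
        and "N {t<..} l u" "N {..<t} l u" for l u
    proof (rule case_i[OF lu])
      show "endpoints_near T f l u t \<epsilon> t" for \<epsilon>
        using nabla_near_left_dense[OF \<rho>] by (simp add: endpoints_near_def)
      \<comment> \<open>The two open sides miss only \<open>t\<close>, which the filter
        ignores.\<close>
      have "at t within T = at t within (T \<inter> {t<..} \<union> T \<inter> {..<t})"
        unfolding at_within_def by (rule arg_cong[where f = "\<lambda>S. inf (nhds t) (principal S)"]) auto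
      then show "\<forall>\<^sub>F s in at t within T. endpoints_near T f l u t \<epsilon> s" if "\<epsilon> > 0" for \<epsilon>
        using \<open>N {t<..} l u\<close> \<open>N {..<t} l u\<close> that by (simp add: N_def at_within_union eventually_sup)
    qed
    have onesided: "has_onesided_nabla_uniformly H T ?lo l t" "has_onesided_nabla_uniformly H T ?up u t"
      if "N A l u" "t islimpt T \<inter> A" "A = (+) t ` H" "0 \<notin> H" for A H l u
      using that by (auto intro!: has_onesided_nabla_uniformlyI[OF \<rho>]
          simp: N_def endpoints_near_def eventually_conj_iff)
    have "x \<in> (+) t ` H \<longleftrightarrow> x - t \<in> H" for x H
      by (force simp: image_iff)
    then have shift: "{t<..} = (+) t ` {0<..}" "{..<t} = (+) t ` {..<0}"
      by auto
    \<comment> \<open>Here \<open>l\<close> and \<open>u\<close> are the slopes on the right; on the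
      left they are exchanged.\<close>
    have mixed: ?thesis
      if lu: "l = lower F \<and> u = upper F \<or> l = upper F \<and> u = lower F"
        and R: "N {t<..} l u" and L: "N {..<t} u l" for l u
    proof (cases "t islimpt T \<inter> {t<..} \<and> t islimpt T \<inter> {..<t}")
      case True
      have "has_right_nabla_uniformly T ?lo l t" "has_right_nabla_uniformly T ?up u t"
        "has_left_nabla_uniformly T ?lo u t" "has_left_nabla_uniformly T ?up l t"
        using onesided[OF R _ shift(1)] onesided[OF L _ shift(2)] True by auto
      moreover have "(\<forall>\<alpha>\<in>{0..1}. level F \<alpha> = {l \<alpha>..u \<alpha>}) \<or> (\<forall>\<alpha>\<in>{0..1}. level F \<alpha> = {u \<alpha>..l \<alpha>})"
        using lu lev by blast
      ultimately show ?thesis by blast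
    next
      \<comment> \<open>A one-sided derivative does not exist on a side without limit points when
        the backward jump is \<open>t\<close>. That side instead adopts the choice of the other one,
        which gives case (i).\<close>
      case False
      then show ?thesis
        using same[of l u] same[of u l] isolated lu R L by blast
    qed
    show ?thesis
      using sides[of "{t<..}"] sides[of "{..<t}"] same mixed by blast
  qed
qed

end
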